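(* Let $X\subseteq\mathbb{R}^d$ and $\Omega\subseteq\mathbb{R}^D$ be closed and let $\varphi\in C_0(X\times\Omega)$. Let $\mathcal{G}^*(\Omega,X)$ be the dual space of $\mathcal{G}(\Omega,X)$. Then $\mathcal{G}^*(\Omega,X)\cong\mathcal{F}(X,\Omega)$, i.e. the two spaces are isometrically isomorphic.
   Context: $C_0$ denotes continuous real functions vanishing at infinity, with the supremum norm. $\mathcal{M}(S)$ is the Banach space of signed, finite, regular Borel (Radon) measures on $S$ with total variation norm $\|\mu\|_{\mathcal{M}(S)}=|\mu|(S)$. For $\mu\in\mathcal{M}(\Omega)$ let $(A\mu)(x)=\int_\Omega\varphi(x,w)\,d\mu(w)$, $x\in X$. The integral RKBS is $\mathcal{F}(X,\Omega):=\{f:X\to\mathbb{R}\mid\exists\mu\in\mathcal{M}(\Omega),\ f=A\mu\}$ with norm $\|f\|_{\mathcal{F}(X,\Omega)}:=\inf_{f=A\mu}\|\mu\|_{\mathcal{M}(\Omega)}$ (so it is the quotient $\mathcal{M}(\Omega)/\mathcal{N}(A)$, $\mathcal{N}(A)$ the null space of $A$). For $\rho\in\mathcal{M}(X)$ let $(A^*\rho)(w)=\int_X\varphi(x,w)\,d\rho(x)$, $w\in\Omega$. Then $\mathcal{G}(\Omega,X):=\{g\in C_0(\Omega)\mid\exists\rho\in\mathcal{M}(X),\ A^*\rho=g\}$ with norm $\|g\|_{\mathcal{G}(\Omega,X)}:=\|g\|_{C_0(\Omega)}=\sup_{w\in\Omega}|g(w)|$. *)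

theory Defs
  imports "HOL-Analysis.Analysis"
begin

text \<open>
  A real function on a subset \<open>S\<close> of a type is represented by its extension by 0 to the whole
  type, and likewise a set function on a sigma-algebra and a functional on a space of functions.
  All vector spaces below are then sets of real-valued functions with the pointwise operations.
\<close>

section \<open>Continuous functions vanishing at infinity\<close>

definition C0 :: "'a::topological_space set \<Rightarrow> ('a \<Rightarrow> real) set" where
  "C0 S = {f. continuous_on S f \<and> (\<forall>x. x \<notin> S \<longrightarrow> f x = 0) \<and>
     (\<forall>\<epsilon>>0. \<exists>K. compact K \<and> K \<subseteq> S \<and> (\<forall>x\<in>S - K. \<bar>f x\<bar> < \<epsilon>))}"

text \<open>The element 0 only matters for \<open>S = {}\<close>, where the supremum of the empty set of reals would be
  unspecified.\<close>

definition sup_norm :: "'a set \<Rightarrow> ('a \<Rightarrow> real) \<Rightarrow> real" where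
  "sup_norm S f = Sup (insert 0 ((\<lambda>x. \<bar>f x\<bar>) ` S))"

section \<open>Signed Radon measures\<close>

abbreviation borel_sets :: "'a::topological_space set \<Rightarrow> 'a set set" where
  "borel_sets S \<equiv> sets (restrict_space borel S)"

definition signed_measure :: "'a::topological_space set \<Rightarrow> ('a set \<Rightarrow> real) \<Rightarrow> bool" where
  "signed_measure S \<mu> \<longleftrightarrow>
     (\<forall>E. E \<notin> borel_sets S \<longrightarrow> \<mu> E = 0) \<and> \<mu> {} = 0 \<and>
     (\<forall>A :: nat \<Rightarrow> 'a set. range A \<subseteq> borel_sets S \<longrightarrow> disjoint_family A \<longrightarrow>
        (\<lambda>n. \<mu> (A n)) sums \<mu> (\<Union>n. A n))"

definition variation :: "'a::topological_space set \<Rightarrow> ('a set \<Rightarrow> real) \<Rightarrow> 'a set \<Rightarrow> ennreal" where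
  "variation S \<mu> E =
     (SUP A \<in> {A :: nat \<Rightarrow> 'a set. range A \<subseteq> borel_sets S \<and> disjoint_family A \<and> (\<Union>n. A n) = E}.
        \<Sum>n. ennreal \<bar>\<mu> (A n)\<bar>)"

definition regular_signed_measure :: "'a::topological_space set \<Rightarrow> ('a set \<Rightarrow> real) \<Rightarrow> bool" where
  "regular_signed_measure S \<mu> \<longleftrightarrow>
     (\<forall>E\<in>borel_sets S.
        variation S \<mu> E = (SUP K \<in> {K. compact K \<and> K \<subseteq> E}. variation S \<mu> K) \<and>
        variation S \<mu> E = (INF U \<in> {U. openin (top_of_set S) U \<and> E \<subseteq> U}. variation S \<mu> U))"

definition radon_measures :: "'a::topological_space set \<Rightarrow> ('a set \<Rightarrow> real) set" where
  "radon_measures S =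
     {\<mu>. signed_measure S \<mu> \<and> variation S \<mu> S < \<infinity> \<and> regular_signed_measure S \<mu>}"

definition tv_norm :: "'a::topological_space set \<Rightarrow> ('a set \<Rightarrow> real) \<Rightarrow> real" where
  "tv_norm S \<mu> = enn2real (variation S \<mu> S)"

text \<open>Integration uses the Jordan decomposition of \<open>\<mu>\<close> into the two finite positive measures
  \<open>(\<bar>\<mu>\<bar> + \<mu>) / 2\<close> and \<open>(\<bar>\<mu>\<bar> - \<mu>) / 2\<close>. The second one is the positive part of \<open>-\<mu>\<close>.\<close>

definition positive_part :: "'a::topological_space set \<Rightarrow> ('a set \<Rightarrow> real) \<Rightarrow> 'a measure" where
  "positive_part S \<mu> =
     measure_of S (borel_sets S) (\<lambda>E. ennreal ((enn2real (variation S \<mu> E) + \<mu> E) / 2))"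

definition signed_integral ::
    "'a::topological_space set \<Rightarrow> ('a set \<Rightarrow> real) \<Rightarrow> ('a \<Rightarrow> real) \<Rightarrow> real" where
  "signed_integral S \<mu> f =
     integral\<^sup>L (positive_part S \<mu>) f - integral\<^sup>L (positive_part S (\<lambda>E. - \<mu> E)) f"

section \<open>The integral RKBS and its predual\<close>

definition A_op :: "('a::topological_space \<times> 'b::topological_space \<Rightarrow> real) \<Rightarrow>
    'a set \<Rightarrow> 'b set \<Rightarrow> ('b set \<Rightarrow> real) \<Rightarrow> 'a \<Rightarrow> real" where
  "A_op \<phi> X \<Omega> \<mu> = (\<lambda>x. if x \<in> X then signed_integral \<Omega> \<mu> (\<lambda>w. \<phi> (x, w)) else 0)"

definition A_adj :: "('a::topological_space \<times> 'b::topological_space \<Rightarrow> real) \<Rightarrow>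
    'a set \<Rightarrow> 'b set \<Rightarrow> ('a set \<Rightarrow> real) \<Rightarrow> 'b \<Rightarrow> real" where
  "A_adj \<phi> X \<Omega> \<rho> = (\<lambda>w. if w \<in> \<Omega> then signed_integral X \<rho> (\<lambda>x. \<phi> (x, w)) else 0)"

definition F_space :: "('a::topological_space \<times> 'b::topological_space \<Rightarrow> real) \<Rightarrow>
    'a set \<Rightarrow> 'b set \<Rightarrow> ('a \<Rightarrow> real) set" where
  "F_space \<phi> X \<Omega> = {f. \<exists>\<mu>\<in>radon_measures \<Omega>. f = A_op \<phi> X \<Omega> \<mu>}"

definition F_norm :: "('a::topological_space \<times> 'b::topological_space \<Rightarrow> real) \<Rightarrow>
    'a set \<Rightarrow> 'b set \<Rightarrow> ('a \<Rightarrow> real) \<Rightarrow> real" where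
  "F_norm \<phi> X \<Omega> f = (INF \<mu> \<in> {\<mu> \<in> radon_measures \<Omega>. f = A_op \<phi> X \<Omega> \<mu>}. tv_norm \<Omega> \<mu>)"

definition G_space :: "('a::topological_space \<times> 'b::topological_space \<Rightarrow> real) \<Rightarrow>
    'a set \<Rightarrow> 'b set \<Rightarrow> ('b \<Rightarrow> real) set" where
  "G_space \<phi> X \<Omega> = {g \<in> C0 \<Omega>. \<exists>\<rho>\<in>radon_measures X. A_adj \<phi> X \<Omega> \<rho> = g}"

abbreviation G_norm :: "'b set \<Rightarrow> ('b \<Rightarrow> real) \<Rightarrow> real" where
  "G_norm \<Omega> \<equiv> sup_norm \<Omega>"

section \<open>Dual spaces and isometric isomorphisms\<close>

definition linear_on_space :: "('i \<Rightarrow> real) set \<Rightarrow> (('i \<Rightarrow> real) \<Rightarrow> real) \<Rightarrow> bool" where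
  "linear_on_space V L \<longleftrightarrow>
     (\<forall>f\<in>V. \<forall>g\<in>V. L (\<lambda>i. f i + g i) = L f + L g) \<and>
     (\<forall>c. \<forall>f\<in>V. L (\<lambda>i. c * f i) = c * L f)"

definition dual_space ::
    "('i \<Rightarrow> real) set \<Rightarrow> (('i \<Rightarrow> real) \<Rightarrow> real) \<Rightarrow> (('i \<Rightarrow> real) \<Rightarrow> real) set" where
  "dual_space V N =
     {L. linear_on_space V L \<and> (\<exists>C. \<forall>f\<in>V. \<bar>L f\<bar> \<le> C * N f) \<and> (\<forall>f. f \<notin> V \<longrightarrow> L f = 0)}"

definition dual_norm ::
    "('i \<Rightarrow> real) set \<Rightarrow> (('i \<Rightarrow> real) \<Rightarrow> real) \<Rightarrow> (('i \<Rightarrow> real) \<Rightarrow> real) \<Rightarrow> real" where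
  "dual_norm V N L = (SUP f \<in> {f \<in> V. N f \<le> 1}. \<bar>L f\<bar>)"

definition isometrically_isomorphic ::
    "('i \<Rightarrow> real) set \<Rightarrow> (('i \<Rightarrow> real) \<Rightarrow> real) \<Rightarrow>
     ('j \<Rightarrow> real) set \<Rightarrow> (('j \<Rightarrow> real) \<Rightarrow> real) \<Rightarrow> bool" where
  "isometrically_isomorphic V N W N' \<longleftrightarrow>
     (\<exists>T. bij_betw T V W \<and>
        (\<forall>f\<in>V. \<forall>g\<in>V. T (\<lambda>i. f i + g i) = (\<lambda>j. T f j + T g j)) \<and>
        (\<forall>c. \<forall>f\<in>V. T (\<lambda>i. c * f i) = (\<lambda>j. c * T f j)) \<and>
        (\<forall>f\<in>V. N' (T f) = N f))"

end

theory Submission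
  imports Defs
begin

text \<open>
  The isomorphism sends \<open>L\<close> in the dual of \<open>\<G>\<close> to the function \<open>x \<mapsto> L (\<phi>(x, \<cdot>))\<close>; this makes sense because
  \<open>\<phi>(x, \<cdot>) = A\<^sup>* \<delta>\<^sub>x\<close> lies in \<open>\<G>\<close>. By the Hahn-Banach and Riesz theorems \<open>L\<close> is integration against a
  measure \<open>\<sigma>\<close> with \<open>\<parallel>\<sigma>\<parallel> \<le> \<parallel>L\<parallel>\<close>, so the image of \<open>L\<close> is \<open>A \<sigma>\<close>. By Fubini's theorem
  \<open>\<integral> A\<^sup>* \<rho> d\<mu> = \<integral> A \<mu> d\<rho>\<close>, so two measures represent the same functional on \<open>\<G>\<close> iff their images under \<open>A\<close>
  agree. Hence the measures \<open>\<mu>\<close> with \<open>A \<mu> = A \<sigma>\<close> are exactly those representing \<open>L\<close>; they all satisfy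
  \<open>\<parallel>L\<parallel> \<le> \<parallel>\<mu>\<parallel>\<close>, with equality for \<open>\<sigma>\<close>.

  For the Riesz theorem, the Hahn-Banach extension is taken to all bounded functions. Its values on
  indicator functions are a finitely additive set function, which a Caratheodory construction
  regularizes to a Borel measure with the same integrals of \<open>C\<^sub>0\<close> functions.
\<close>

section \<open>The Hahn-Banach theorem on spaces of functions\<close>

text \<open>Extending to all bounded functions, not just to \<open>C0\<close>, provides values on
  every indicator at once, so the candidate measure needs no approximation by continuous functions.
  The price is that these values are only finitely additive and may carry mass at infinity. What
  survives regularization is a one-sided comparison on open and another on compact sets. That is
  enough, because for \<open>f\<close> in \<open>C0\<close> and \<open>t > 0\<close> the set where
  \<open>f \<ge> t\<close> is compact and the set where \<open>f > t\<close> is relatively open.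

  The second obstacle is sign. A functional on a subspace need not be positive, and the isometry
  needs the masses of both parts to add up to at most the norm of \<open>L\<close>; bounding each
  part by that norm would lose a factor 2. This is why Hahn-Banach is stated for sublinear bounds
  rather than for norms.

  Regularity is settled once: finite signed Borel measures on closed subsets of complete second
  countable spaces are regular, so from there on only finiteness has to be tracked.\<close>

definition function_space :: "('i \<Rightarrow> real) set \<Rightarrow> bool" where
  "function_space V \<longleftrightarrow> (\<lambda>i. 0) \<in> V \<and> (\<forall>f\<in>V. \<forall>g\<in>V. (\<lambda>i. f i + g i) \<in> V) \<and>
     (\<forall>c. \<forall>f\<in>V. (\<lambda>i. c * f i) \<in> V)"

text \<open>Homogeneity is asked only as an inequality: scaling back by \<open>inverse c\<close>
  gives equality for positive \<open>c\<close>, and subadditivity together with the case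
  \<open>c = 0\<close> forces the value 0 at 0.\<close>

definition sublinear_on :: "('i \<Rightarrow> real) set \<Rightarrow> (('i \<Rightarrow> real) \<Rightarrow> real) \<Rightarrow> bool" where
  "sublinear_on V p \<longleftrightarrow> (\<forall>f\<in>V. \<forall>g\<in>V. p (\<lambda>i. f i + g i) \<le> p f + p g) \<and>
     (\<forall>c\<ge>0. \<forall>f\<in>V. p (\<lambda>i. c * f i) \<le> c * p f)"

lemma function_spaceD:
  assumes "function_space V"
  shows "(\<lambda>i. 0) \<in> V" "f \<in> V \<Longrightarrow> g \<in> V \<Longrightarrow> (\<lambda>i. f i + g i) \<in> V" "f \<in> V \<Longrightarrow> (\<lambda>i. c * f i) \<in> V"
    "f \<in> V \<Longrightarrow> (\<lambda>i. - f i) \<in> V" "f \<in> V \<Longrightarrow> g \<in> V \<Longrightarrow> (\<lambda>i. f i - g i) \<in> V"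
proof -
  show *: "(\<lambda>i. 0) \<in> V" "\<And>f g. f \<in> V \<Longrightarrow> g \<in> V \<Longrightarrow> (\<lambda>i. f i + g i) \<in> V"
    "\<And>c f. f \<in> V \<Longrightarrow> (\<lambda>i. c * f i) \<in> V"
    using assms by (auto simp: function_space_def)
  show neg: "(\<lambda>i. - f i) \<in> V" if "f \<in> V" for f
    using *(3)[OF that, of "-1"] by simp
  show "(\<lambda>i. f i - g i) \<in> V" if "f \<in> V" "g \<in> V"
    using *(2)[OF that(1) neg[OF that(2)]] by simp
qed

lemma sublinear_onD:
  assumes "function_space V" and "sublinear_on V p"
  shows "f \<in> V \<Longrightarrow> g \<in> V \<Longrightarrow> p (\<lambda>i. f i + g i) \<le> p f + p g"
    and "0 \<le> c \<Longrightarrow> f \<in> V \<Longrightarrow> p (\<lambda>i. c * f i) = c * p f"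
    and "p (\<lambda>i. 0) = 0"
    and "f \<in> V \<Longrightarrow> - p (\<lambda>i. - f i) \<le> p f"
proof -
  note V = function_spaceD[OF assms(1)]
  show sub: "\<And>f g. f \<in> V \<Longrightarrow> g \<in> V \<Longrightarrow> p (\<lambda>i. f i + g i) \<le> p f + p g"
    using assms(2) by (auto simp: sublinear_on_def)
  have hom: "\<And>c f. 0 \<le> c \<Longrightarrow> f \<in> V \<Longrightarrow> p (\<lambda>i. c * f i) \<le> c * p f"
    using assms(2) by (auto simp: sublinear_on_def)
  show zero: "p (\<lambda>i. 0) = 0"
    using sub[OF V(1) V(1)] hom[OF _ V(1), of 0] by simp
  show "p (\<lambda>i. c * f i) = c * p f" if "0 \<le> c" "f \<in> V"
  proof (cases "c = 0")
    case False
    then have "p f \<le> inverse c * p (\<lambda>i. c * f i)"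
      using hom[of "inverse c" "\<lambda>i. c * f i"] that V(3)[OF that(2)]
      by (simp add: mult.assoc[symmetric])
    then have "c * p f \<le> p (\<lambda>i. c * f i)"
      using False that(1) by (simp add: field_simps)
    with hom[OF that] show ?thesis by simp
  qed (use zero in simp)
  show "- p (\<lambda>i. - f i) \<le> p f" if "f \<in> V"
    using sub[OF that V(4)[OF that]] zero by simp
qed

text \<open>The witness is the infimum of \<open>p (f + g) - l g\<close> over \<open>g\<close> in
  the cone \<open>K\<close>. It is finite because
  \<open>l g \<le> p g \<le> p (f + g) + p (- f)\<close>, and sublinear because \<open>l\<close> is
  superadditive on \<open>K\<close>. There are two uses: a ray \<open>K\<close> turns minimality
  into additivity, and a subspace \<open>K\<close> forces agreement with a given functional.\<close>

lemma sublinear_on_infimal_convolution: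
  assumes V: "function_space V" and p: "sublinear_on V p"
    and K: "K \<subseteq> V" "(\<lambda>i. 0) \<in> K" "\<And>f g. f \<in> K \<Longrightarrow> g \<in> K \<Longrightarrow> (\<lambda>i. f i + g i) \<in> K"
      "\<And>c f. 0 \<le> c \<Longrightarrow> f \<in> K \<Longrightarrow> (\<lambda>i. c * f i) \<in> K"
    and l: "\<And>f g. f \<in> K \<Longrightarrow> g \<in> K \<Longrightarrow> l f + l g \<le> l (\<lambda>i. f i + g i)"
      "\<And>c f. 0 \<le> c \<Longrightarrow> f \<in> K \<Longrightarrow> c * l f \<le> l (\<lambda>i. c * f i)" "\<And>f. f \<in> K \<Longrightarrow> l f \<le> p f"
  obtains r where "sublinear_on V r" "\<And>f. f \<in> V \<Longrightarrow> r f \<le> p f"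
    "\<And>f g. f \<in> V \<Longrightarrow> g \<in> K \<Longrightarrow> r f \<le> p (\<lambda>i. f i + g i) - l g" "\<And>f. f \<notin> V \<Longrightarrow> r f = 0"
proof -
  note V' = function_spaceD[OF V] and p' = sublinear_onD[OF V p]
  define r where "r f = (if f \<in> V then INF g\<in>K. p (\<lambda>i. f i + g i) - l g else 0)" for f
  have bdd: "bdd_below ((\<lambda>g. p (\<lambda>i. f i + g i) - l g) ` K)" if "f \<in> V" for f
  proof (rule bdd_belowI2[of _ "- p (\<lambda>i. - f i)"])
    fix g assume g: "g \<in> K"
    then have "g \<in> V" using K by auto
    then have "p (\<lambda>i. (f i + g i) + - f i) \<le> p (\<lambda>i. f i + g i) + p (\<lambda>i. - f i)"
      using that by (intro p' V')
    then show "- p (\<lambda>i. - f i) \<le> p (\<lambda>i. f i + g i) - l g" using l(3)[OF g] by simp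
  qed
  have le: "r f \<le> p (\<lambda>i. f i + g i) - l g" if "f \<in> V" "g \<in> K" for f g
    using that bdd by (auto simp: r_def intro!: cINF_lower)
  have ge: "c \<le> r f" if "f \<in> V" "\<And>g. g \<in> K \<Longrightarrow> c \<le> p (\<lambda>i. f i + g i) - l g" for c f
    using that K(2) by (auto simp: r_def intro!: cINF_greatest)
  have l0: "0 \<le> l (\<lambda>i. 0)"
    using l(2)[OF _ K(2), of 0] by simp
  show thesis
  proof
    show "sublinear_on V r"
      unfolding sublinear_on_def
    proof (intro conjI allI impI ballI)
      fix f g assume fg: "f \<in> V" "g \<in> V"
      \<comment> \<open>The two infima are treated one after the other: \<open>h\<close> competes
        for \<open>f\<close>, \<open>k\<close> competes for \<open>g\<close>, and
        \<open>h + k\<close> is then admissible for \<open>f + g\<close>.\<close>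
      have "r (\<lambda>i. f i + g i) - (p (\<lambda>i. f i + h i) - l h) \<le> r g" if h: "h \<in> K" for h
      proof (rule ge[OF fg(2)])
        fix k assume k: "k \<in> K"
        have "h \<in> V" "k \<in> V" using h k K(1) by auto
        have "r (\<lambda>i. f i + g i) \<le> p (\<lambda>i. (f i + g i) + (h i + k i)) - l (\<lambda>i. h i + k i)"
          using fg h k by (intro le V' K)
        also have "(\<lambda>i. (f i + g i) + (h i + k i)) = (\<lambda>i. (f i + h i) + (g i + k i))"
          by (auto simp: algebra_simps)
        also have "p \<dots> \<le> p (\<lambda>i. f i + h i) + p (\<lambda>i. g i + k i)"
          using fg \<open>h \<in> V\<close> \<open>k \<in> V\<close> by (intro p' V')
        finally show "r (\<lambda>i. f i + g i) - (p (\<lambda>i. f i + h i) - l h) \<le> p (\<lambda>i. g i + k i) - l k"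
          using l(1)[OF h k] by simp
      qed
      then have "r (\<lambda>i. f i + g i) - r g \<le> r f"
        using fg by (intro ge) (auto simp: algebra_simps)
      then show "r (\<lambda>i. f i + g i) \<le> r f + r g" by simp
    next
      fix c :: real and f assume c: "0 \<le> c" and f: "f \<in> V"
      have *: "r (\<lambda>i. c * f i) \<le> c * (p (\<lambda>i. f i + g i) - l g)" if g: "g \<in> K" for g
      proof -
        have "r (\<lambda>i. c * f i) \<le> p (\<lambda>i. c * f i + c * g i) - l (\<lambda>i. c * g i)"
          using c f g by (intro le V' K)
        also have "(\<lambda>i. c * f i + c * g i) = (\<lambda>i. c * (f i + g i))"
          by (simp add: algebra_simps)
        also have "p \<dots> = c * p (\<lambda>i. f i + g i)"
          using c f g K(1) by (intro p' V') auto
        finally show ?thesis using l(2)[OF c g] by (simp add: algebra_simps)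
      qed
      show "r (\<lambda>i. c * f i) \<le> c * r f"
      proof (cases "c = 0")
        case True
        then show ?thesis using *[OF K(2)] by simp
      next
        case False
        then have "r (\<lambda>i. c * f i) / c \<le> r f"
          using c f * by (intro ge) (auto simp: field_simps)
        then show ?thesis using False c by (simp add: field_simps)
      qed
    qed
    show "r f \<le> p f" if "f \<in> V" for f
      using le[OF that K(2)] l0 by simp
  qed (use le in \<open>auto simp: r_def\<close>)
qed

text \<open>Lowering \<open>q\<close> along the ray through \<open>g\<close> gives a sublinear
  \<open>r \<le> q\<close> with \<open>r f \<le> q (f + t g) - t q g\<close> for
  \<open>t \<ge> 0\<close>. Minimality yields \<open>r = q\<close>, and \<open>t = 1\<close> is then
  the missing half of additivity. Fixing the value 0 outside \<open>V\<close> lets minimality speak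
  of equality of functions.\<close>

lemma minimal_sublinear_is_linear:
  assumes V: "function_space V" and q: "sublinear_on V q" "\<And>f. f \<notin> V \<Longrightarrow> q f = 0"
    and min: "\<And>r. sublinear_on V r \<Longrightarrow> (\<And>f. f \<notin> V \<Longrightarrow> r f = 0) \<Longrightarrow> (\<And>f. f \<in> V \<Longrightarrow> r f \<le> q f) \<Longrightarrow> r = q"
  shows "linear_on_space V q"
proof -
  note V' = function_spaceD[OF V] and q' = sublinear_onD[OF V q(1)]
  have add: "q (\<lambda>i. f i + g i) = q f + q g" if fg: "f \<in> V" "g \<in> V" for f g
  proof -
    define K where "K = {\<lambda>i. t * g i | t. 0 \<le> t}"
    have KV: "K \<subseteq> V" using V' fg by (auto simp: K_def)
    have K0: "(\<lambda>i. 0) \<in> K" unfolding K_def by (intro CollectI exI[of _ 0]) auto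
    have K_add: "(\<lambda>i. a i + b i) \<in> K \<and> q a + q b \<le> q (\<lambda>i. a i + b i)" if "a \<in> K" "b \<in> K" for a b
    proof -
      obtain s t where st: "a = (\<lambda>i. s * g i)" "b = (\<lambda>i. t * g i)" "0 \<le> s" "0 \<le> t"
        using \<open>a \<in> K\<close> \<open>b \<in> K\<close> by (auto simp: K_def)
      have eq: "(\<lambda>i. a i + b i) = (\<lambda>i. (s + t) * g i)"
        by (simp add: st algebra_simps)
      have "q a + q b = q (\<lambda>i. a i + b i)"
        unfolding eq using st fg(2) q'(2)[of _ g] by (simp add: distrib_right[of s t "q g"])
      moreover have "(\<lambda>i. (s + t) * g i) \<in> K"
        using st unfolding K_def by (intro CollectI exI[of _ "s + t"]) auto
      ultimately show ?thesis unfolding eq by simp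
    qed
    have K_mult: "(\<lambda>i. c * a i) \<in> K" if "a \<in> K" "0 \<le> c" for a c
    proof -
      obtain s where "a = (\<lambda>i. s * g i)" "0 \<le> s"
        using \<open>a \<in> K\<close> by (auto simp: K_def)
      then show ?thesis
        using that(2) by (auto simp: K_def intro!: exI[of _ "c * s"])
    qed
    obtain r where r: "sublinear_on V r" "\<And>f. f \<in> V \<Longrightarrow> r f \<le> q f"
      "\<And>f g. f \<in> V \<Longrightarrow> g \<in> K \<Longrightarrow> r f \<le> q (\<lambda>i. f i + g i) - q g" "\<And>f. f \<notin> V \<Longrightarrow> r f = 0"
    proof (rule sublinear_on_infimal_convolution[OF V q(1) KV K0, of q], goal_cases)
      case (4 c a)
      then show ?case using KV q'(2) by auto
    next
      case (6 r)
      show ?case by (rule 6(1)[OF 6(2-5)])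
    qed (simp_all add: K_add K_mult)
    have "g \<in> K" unfolding K_def by (intro CollectI exI[of _ 1]) auto
    moreover have "r = q" using r by (intro min) auto
    ultimately have "q f \<le> q (\<lambda>i. f i + g i) - q g" using r(3)[OF fg(1)] by auto
    with q'(1)[OF fg] show ?thesis by simp
  qed
  have neg: "q (\<lambda>i. - f i) = - q f" if "f \<in> V" for f
    using add[OF that V'(4)[OF that]] q'(3) by simp
  have "q (\<lambda>i. c * f i) = c * q f" if f: "f \<in> V" for c f
  proof (cases "0 \<le> c")
    case False
    then show ?thesis
      using neg[of "\<lambda>i. (- c) * f i"] q'(2)[of "- c" f] V'(3)[OF f, of "- c"] f by simp
  qed (use q'(2) f in simp)
  with add show ?thesis by (simp add: linear_on_space_def)
qed

text \<open>Zorn's lemma gives a minimal sublinear functional below \<open>p\<close>, which is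
  linear. A chain is bounded by its pointwise infimum, which is finite since every member is at
  least \<open>- p (- f)\<close> at \<open>f\<close>.\<close>

lemma exists_linear_below_sublinear:
  assumes V: "function_space V" and p: "sublinear_on V p"
  obtains q where "linear_on_space V q" "\<And>f. f \<in> V \<Longrightarrow> q f \<le> p f"
proof -
  note V' = function_spaceD[OF V]
  define A where "A = {q. sublinear_on V q \<and> (\<forall>f\<in>V. q f \<le> p f) \<and> (\<forall>f. f \<notin> V \<longrightarrow> q f = 0)}"
  \<comment> \<open>The order is reversed because \<open>predicate_Zorn\<close> produces maximal
    elements.\<close>
  define P where "P q r \<longleftrightarrow> r \<le> q" for q r :: "('a \<Rightarrow> real) \<Rightarrow> real"
  have po: "partial_order_on A (relation_of P A)"
    by (auto simp: partial_order_on_def preorder_on_def refl_on_def trans_def antisym_def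
        relation_of_def P_def)
  have pA: "(\<lambda>f. if f \<in> V then p f else 0) \<in> A"
    using p V' by (auto simp: A_def sublinear_on_def)
  have ub: "\<exists>u\<in>A. \<forall>q\<in>C. P q u" if C: "C \<in> Chains (relation_of P A)" for C
  proof (cases "C = {}")
    case False
    have CA: "q \<in> A" if "q \<in> C" for q
      using C that by (auto simp: Chains_def relation_of_def)
    have C_total: "q \<le> r \<or> r \<le> q" if "q \<in> C" "r \<in> C" for q r
      using C that by (auto simp: Chains_def relation_of_def P_def)
    have CD: "sublinear_on V q" "\<And>f. f \<in> V \<Longrightarrow> q f \<le> p f" "\<And>f. f \<notin> V \<Longrightarrow> q f = 0" if "q \<in> C" for q
      using CA[OF that] by (auto simp: A_def)
    define u where "u f = (if f \<in> V then INF q\<in>C. q f else 0)" for f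
    have bdd: "bdd_below ((\<lambda>q. q f) ` C)" if f: "f \<in> V" for f
    proof (rule bdd_belowI2[of _ "- p (\<lambda>i. - f i)"])
      fix q assume q: "q \<in> C"
      have "q (\<lambda>i. - f i) \<le> p (\<lambda>i. - f i)" using CD(2)[OF q] V' f by auto
      then show "- p (\<lambda>i. - f i) \<le> q f"
        using sublinear_onD(4)[OF V CD(1)[OF q] f] by linarith
    qed
    have le: "u f \<le> q f" if "f \<in> V" "q \<in> C" for f q
      using that bdd by (auto simp: u_def intro!: cINF_lower)
    have ge: "c \<le> u f" if "f \<in> V" "\<And>q. q \<in> C \<Longrightarrow> c \<le> q f" for c f
      using that False by (auto simp: u_def intro!: cINF_greatest)
    have "sublinear_on V u"
      unfolding sublinear_on_def
    proof (intro conjI allI impI ballI)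
      fix f g assume fg: "f \<in> V" "g \<in> V"
      have "u (\<lambda>i. f i + g i) - q f \<le> u g" if q: "q \<in> C" for q
      proof (rule ge[OF fg(2)])
        fix r assume r: "r \<in> C"
        \<comment> \<open>Infima of sublinear functionals need not be subadditive; in a chain, one
          \<open>s\<close> below both \<open>q\<close> and \<open>r\<close> serves \<open>f\<close>
          and \<open>g\<close> at once.\<close>
        obtain s where s: "s \<in> C" "s \<le> q" "s \<le> r"
          using C_total[OF q r] q r by auto
        have "u (\<lambda>i. f i + g i) \<le> s (\<lambda>i. f i + g i)"
          using fg s V' by (intro le) auto
        also have "\<dots> \<le> s f + s g"
          using sublinear_onD(1)[OF V CD(1)[OF s(1)] fg] .
        also have "\<dots> \<le> q f + r g"
          using s by (intro add_mono) (auto simp: le_fun_def)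
        finally show "u (\<lambda>i. f i + g i) - q f \<le> r g" by simp
      qed
      then have "u (\<lambda>i. f i + g i) - u g \<le> u f"
        using fg by (intro ge) (auto simp: algebra_simps)
      then show "u (\<lambda>i. f i + g i) \<le> u f + u g" by simp
    next
      fix c :: real and f assume c: "0 \<le> c" and f: "f \<in> V"
      have *: "u (\<lambda>i. c * f i) \<le> c * q f" if "q \<in> C" for q
        using le[OF V'(3)[OF f] that, of c] sublinear_onD(2)[OF V CD(1)[OF that] c f] by simp
      show "u (\<lambda>i. c * f i) \<le> c * u f"
      proof (cases "c = 0")
        case True
        then show ?thesis using * False by auto
      next
        case c0: False
        then have "u (\<lambda>i. c * f i) / c \<le> u f"
          using c f * by (intro ge) (auto simp: field_simps)
        then show ?thesis using c0 c by (simp add: field_simps)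
      qed
    qed
    moreover have "\<forall>f\<in>V. u f \<le> p f"
      using False le CD(2) by (metis all_not_in_conv order_trans)
    ultimately have "u \<in> A" by (auto simp: A_def u_def)
    moreover have "u \<le> q" if "q \<in> C" for q
      using le[OF _ that] CD(3)[OF that] by (force simp: le_fun_def u_def)
    ultimately show ?thesis by (auto simp: P_def)
  qed (use pA in auto)
  obtain q where q: "q \<in> A" "\<And>r. r \<in> A \<Longrightarrow> P q r \<Longrightarrow> r = q"
    using predicate_Zorn[OF po ub] by blast
  have "linear_on_space V q"
  proof (rule minimal_sublinear_is_linear[OF V])
    fix r assume r: "sublinear_on V r" "\<And>f. f \<notin> V \<Longrightarrow> r f = 0" "\<And>f. f \<in> V \<Longrightarrow> r f \<le> q f"
    have "r \<in> A" using q(1) r by (auto simp: A_def intro: order_trans)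
    moreover have "P q r" using q(1) r by (fastforce simp: A_def P_def le_fun_def)
    ultimately show "r = q" using q(2) by blast
  qed (use q(1) in \<open>auto simp: A_def\<close>)
  with q(1) show thesis by (intro that) (auto simp: A_def)
qed

text \<open>\<open>p\<close> is first lowered to \<open>r\<close> by infimal convolution with
  \<open>L\<close> on \<open>G\<close>. The choice \<open>g = - f\<close> there gives
  \<open>r f \<le> L f\<close> on \<open>G\<close>, so every linear \<open>q \<le> r\<close> is at
  most \<open>L\<close> on \<open>G\<close>; the same inequality at \<open>- f\<close> turns this
  into equality.\<close>

theorem Hahn_Banach_sublinear:
  assumes V: "function_space V" and p: "sublinear_on V p"
    and G: "function_space G" "G \<subseteq> V" and L: "linear_on_space G L" "\<And>f. f \<in> G \<Longrightarrow> L f \<le> p f"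
  obtains q where "linear_on_space V q" "\<And>f. f \<in> V \<Longrightarrow> q f \<le> p f" "\<And>f. f \<in> G \<Longrightarrow> q f = L f"
proof -
  note V' = function_spaceD[OF V] and G' = function_spaceD[OF G(1)]
  have L_add: "L (\<lambda>i. f i + g i) = L f + L g" if "f \<in> G" "g \<in> G" for f g
    using L(1) that by (auto simp: linear_on_space_def)
  have L_mult: "L (\<lambda>i. c * f i) = c * L f" if "f \<in> G" for c f
    using L(1) that by (auto simp: linear_on_space_def)
  have L_neg: "L (\<lambda>i. - f i) = - L f" if "f \<in> G" for f
    using L_mult[OF that, of "-1"] by simp
  obtain r where r: "sublinear_on V r" "\<And>f. f \<in> V \<Longrightarrow> r f \<le> p f"
      "\<And>f g. f \<in> V \<Longrightarrow> g \<in> G \<Longrightarrow> r f \<le> p (\<lambda>i. f i + g i) - L g"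
    by (rule sublinear_on_infimal_convolution[OF V p G(2) G'(1), of L])
      (use G' L(2) L_add L_mult in auto)
  obtain q where q: "linear_on_space V q" "\<And>f. f \<in> V \<Longrightarrow> q f \<le> r f"
    using exists_linear_below_sublinear[OF V r(1)] by blast
  have q_le: "q f \<le> L f" if "f \<in> G" for f
    using q(2)[of f] r(3)[of f "\<lambda>i. - f i"] sublinear_onD(3)[OF V p] G'(4)[OF that] G(2)
      L_neg[OF that] that by auto
  have "q (\<lambda>i. - f i) = - q f" if "f \<in> G" for f
  proof -
    have "q (\<lambda>i. (-1) * f i) = (-1) * q f"
      using q(1) that G(2) unfolding linear_on_space_def by blast
    then show ?thesis by simp
  qed
  then have "q f = L f" if "f \<in> G" for f
    using q_le[OF that] q_le[OF G'(4)[OF that]] L_neg that by fastforce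
  moreover have "q f \<le> p f" if "f \<in> V" for f
    using q(2) r(2) that order_trans by blast
  ultimately show thesis using q(1) that by blast
qed

section \<open>Regularization of finitely additive set functions\<close>

text \<open>Finitely many closed balls, each inside some \<open>U n\<close>, cover \<open>K\<close>,
  and \<open>C k\<close> collects those assigned to \<open>U k\<close>. With such a decomposition,
  finite subadditivity yields countable subadditivity on open sets.\<close>

lemma compact_subset_Union_decompose:
  fixes K :: "'a::metric_space set" and U :: "nat \<Rightarrow> 'a set"
  assumes K: "compact K" "K \<subseteq> (\<Union>n. U n)" and U: "\<And>n. open (U n)"
  obtains N and C :: "nat \<Rightarrow> 'a set"
  where "\<And>n. compact (C n)" "\<And>n. C n \<subseteq> U n" "K = (\<Union>n<N. C n)"
proof -
  have "\<exists>n r. 0 < r \<and> cball x r \<subseteq> U n" if x: "x \<in> K" for x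
  proof -
    obtain n where "x \<in> U n" using x K(2) by auto
    then show ?thesis using U open_contains_cball by metis
  qed
  then obtain n r where nr: "\<And>x. x \<in> K \<Longrightarrow> 0 < r x" "\<And>x. x \<in> K \<Longrightarrow> cball x (r x) \<subseteq> U (n x)"
    by metis
  have "K \<subseteq> (\<Union>x\<in>K. ball x (r x))" using nr by auto
  then obtain T where T: "T \<subseteq> K" "finite T" "K \<subseteq> (\<Union>x\<in>T. ball x (r x))"
    using compactE_image[OF K(1), of K "\<lambda>x. ball x (r x)"] by auto
  define C where "C k = K \<inter> (\<Union>x\<in>{x\<in>T. n x = k}. cball x (r x))" for k
  obtain N where N: "\<And>x. x \<in> T \<Longrightarrow> n x < N"
    using finite_nat_set_iff_bounded[of "n ` T"] T(2) by auto
  show thesis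
  proof
    show "compact (C k)" for k
      unfolding C_def using K(1) T(2) by (intro compact_Int_closed closed_UN) auto
    show "C k \<subseteq> U k" for k
      using nr T(1) by (fastforce simp: C_def)
    show "K = (\<Union>k<N. C k)"
    proof
      show "K \<subseteq> (\<Union>k<N. C k)"
      proof
        fix y assume y: "y \<in> K"
        then obtain x where "x \<in> T" "y \<in> ball x (r x)" using T(3) by auto
        then have "y \<in> C (n x)" "n x < N" using y N by (auto simp: C_def)
        then show "y \<in> (\<Union>k<N. C k)" by blast
      qed
    qed (auto simp: C_def)
  qed
qed

text \<open>\<open>l\<close> measures open sets from inside by compact sets, and
  \<open>\<mu>\<close> extends \<open>l\<close> from outside by open sets. Both inequalities can be
  strict: mass that compact subsets of an open set do not capture is lost, and a compact set picks
  up mass sitting arbitrarily close to it.\<close>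

lemma finitely_additive_regularization:
  fixes m :: "'a::metric_space set \<Rightarrow> real"
  assumes nonneg: "\<And>E. 0 \<le> m E" and add: "\<And>E F. E \<inter> F = {} \<Longrightarrow> m (E \<union> F) = m E + m F"
  obtains M where "sets M = sets borel" "\<And>U. open U \<Longrightarrow> emeasure M U \<le> ennreal (m U)"
    "\<And>K. compact K \<Longrightarrow> ennreal (m K) \<le> emeasure M K"
proof -
  have m0: "m {} = 0" using add[of "{}" "{}"] by simp
  have mono: "m E \<le> m F" if "E \<subseteq> F" for E F
    using add[of E "F - E"] nonneg[of "F - E"] that by (simp add: Un_absorb1)
  have subadd: "m (E \<union> F) \<le> m E + m F" for E F
    using add[of E "F - E"] mono[of "F - E" F] by simp
  have subadd_UN: "m (\<Union>n<N. C n) \<le> (\<Sum>n<N. m (C n))" for C and N :: nat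
  proof (induction N)
    case (Suc N)
    have "m (\<Union>n<Suc N. C n) \<le> m (\<Union>n<N. C n) + m (C N)"
      using subadd[of "\<Union>n<N. C n" "C N"] by (simp add: lessThan_Suc Un_commute)
    with Suc show ?case by simp
  qed (simp add: m0)
  define l where "l U = (SUP K\<in>{K. compact K \<and> K \<subseteq> U}. ennreal (m K))" for U
  define \<mu> where "\<mu> E = (INF U\<in>{U. open U \<and> E \<subseteq> U}. l U)" for E
  have l_upper: "ennreal (m K) \<le> l U" if "compact K" "K \<subseteq> U" for K U
    using that by (auto simp: l_def intro!: SUP_upper)
  have l_mono: "l U \<le> l V" if "U \<subseteq> V" for U V
    using that by (auto simp: l_def intro!: SUP_subset_mono)
  have l_m: "l U \<le> ennreal (m U)" for U
    by (auto simp: l_def intro!: SUP_least ennreal_leI mono)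
  have l0: "l {} = 0" using l_m[of "{}"] by (simp add: m0)
  have \<mu>_le: "\<mu> E \<le> l U" if "open U" "E \<subseteq> U" for E U
    using that by (auto simp: \<mu>_def intro!: INF_lower)
  have \<mu>_open: "\<mu> U = l U" if "open U" for U
    using that by (auto simp: \<mu>_def intro!: antisym INF_lower INF_greatest l_mono)
  have \<mu>_mono: "\<mu> E \<le> \<mu> F" if "E \<subseteq> F" for E F
    using that unfolding \<mu>_def by (intro INF_superset_mono) auto
  have l_UN: "l (\<Union>n. U n) \<le> (\<Sum>n. l (U n))" if U: "\<And>n. open (U n)" for U :: "nat \<Rightarrow> 'a set"
    unfolding l_def[of "\<Union>n. U n"]
  proof (intro SUP_least)
    fix K assume "K \<in> {K. compact K \<and> K \<subseteq> (\<Union>n. U n)}"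
    then have K: "compact K" "K \<subseteq> (\<Union>n. U n)" by auto
    obtain N C where C: "\<And>n. compact (C n)" "\<And>n. C n \<subseteq> U n" "K = (\<Union>n<N. C n)"
      by (rule compact_subset_Union_decompose[OF K U]) (rule that)
    have "ennreal (m K) \<le> ennreal (\<Sum>n<N. m (C n))"
      using subadd_UN C(3) by (intro ennreal_leI) auto
    also have "\<dots> = (\<Sum>n<N. ennreal (m (C n)))"
      by (simp add: nonneg sum_ennreal)
    also have "\<dots> \<le> (\<Sum>n<N. l (U n))"
      by (intro sum_mono l_upper C)
    also have "\<dots> \<le> (\<Sum>n. l (U n))"
      by (intro sum_le_suminf) auto
    finally show "ennreal (m K) \<le> (\<Sum>n. l (U n))" .
  qed
  have \<mu>_UN: "\<mu> (\<Union>n. A n) \<le> (\<Sum>n. \<mu> (A n))" for A :: "nat \<Rightarrow> 'a set"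
  proof (rule ennreal_le_epsilon)
    fix e :: real assume e: "0 < e" and fin: "(\<Sum>n. \<mu> (A n)) < top"
    have "\<exists>U. open U \<and> A n \<subseteq> U \<and> l U \<le> \<mu> (A n) + ennreal (e * (1/2)^Suc n)" for n
    proof -
      have "\<mu> (A n) \<noteq> \<infinity>"
        using ennreal_suminf_lessD[OF fin, of n] by simp
      from INF_approx_ennreal[OF _ \<mu>_def[of "A n"] this, of "e * (1/2)^Suc n"] e
      show ?thesis by (auto intro: less_imp_le)
    qed
    then obtain U where U: "\<And>n. open (U n)" "\<And>n. A n \<subseteq> U n"
      "\<And>n. l (U n) \<le> \<mu> (A n) + ennreal (e * (1/2)^Suc n)" by metis
    have "\<mu> (\<Union>n. A n) \<le> l (\<Union>n. U n)"
      using U by (intro \<mu>_le) auto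
    also have "\<dots> \<le> (\<Sum>n. l (U n))" by (intro l_UN U)
    also have "\<dots> \<le> (\<Sum>n. \<mu> (A n) + ennreal (e * (1/2)^Suc n))"
      by (intro suminf_le U) auto
    also have "\<dots> = (\<Sum>n. \<mu> (A n)) + (\<Sum>n. ennreal (e * (1/2)^Suc n))"
      by (intro suminf_add[symmetric]) auto
    also have "(\<Sum>n. ennreal (e * (1/2)^Suc n)) = ennreal (e * 1)"
      using e by (intro suminf_ennreal_eq sums_mult power_half_series) auto
    finally show "\<mu> (\<Union>n. A n) \<le> (\<Sum>n. \<mu> (A n)) + ennreal e" by simp
  qed
  interpret P: sigma_algebra UNIV "UNIV :: 'a set set"
    using sigma_algebra_Pow[of UNIV] by simp
  have pos: "positive UNIV \<mu>" by (simp add: positive_def \<mu>_open l0)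
  have oms: "outer_measure_space UNIV \<mu>"
    using pos by (auto simp: outer_measure_space_def increasing_def countably_subadditive_def
        intro: \<mu>_mono \<mu>_UN)
  define L where "L = lambda_system UNIV UNIV \<mu>"
  have L: "measure_space UNIV L \<mu>"
    unfolding L_def by (rule P.caratheodory_lemma[OF oms])
  have "U \<in> L" if U: "open U" for U
    unfolding L_def P.lambda_system_eq
  proof (clarsimp, intro antisym)
    fix E
    have "subadditive UNIV \<mu>"
      using oms pos P.countably_subadditive_subadditive by (simp add: outer_measure_space_def)
    moreover have "(E \<inter> U) \<inter> (E - U) = {}" by auto
    ultimately have "\<mu> ((E \<inter> U) \<union> (E - U)) \<le> \<mu> (E \<inter> U) + \<mu> (E - U)"
      unfolding subadditive_def by blast
    also have "(E \<inter> U) \<union> (E - U) = E" by auto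
    finally show "\<mu> E \<le> \<mu> (E \<inter> U) + \<mu> (E - U)" .
    \<comment> \<open>It is enough to treat an open \<open>V \<supseteq> E\<close>. A compact
      \<open>K \<subseteq> V \<inter> U\<close> is fixed first, then a compact \<open>K'\<close>
      inside \<open>V - K\<close>, which is open and contains \<open>V - U\<close>. As
      \<open>K\<close> and \<open>K'\<close> are disjoint, \<open>m\<close> is additive on them and
      their union competes in \<open>l V\<close>.\<close>
    show "\<mu> (E \<inter> U) + \<mu> (E - U) \<le> \<mu> E"
      unfolding \<mu>_def[of E]
    proof (intro INF_greatest)
      fix V assume "V \<in> {V. open V \<and> E \<subseteq> V}"
      then have V: "open V" "E \<subseteq> V" by auto
      have "\<mu> (E \<inter> U) + \<mu> (E - U) \<le> l (V \<inter> U) + \<mu> (V - U)"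
        using U V by (intro add_mono \<mu>_le \<mu>_mono) auto
      also have "\<dots> = (SUP K\<in>{K. compact K \<and> K \<subseteq> V \<inter> U}. ennreal (m K) + \<mu> (V - U))"
        unfolding l_def by (intro ennreal_SUP_add_left[symmetric]) auto
      also have "\<dots> \<le> l V"
      proof (intro SUP_least)
        fix K assume "K \<in> {K. compact K \<and> K \<subseteq> V \<inter> U}"
        then have K: "compact K" "K \<subseteq> V \<inter> U" by auto
        have "ennreal (m K) + \<mu> (V - U) \<le> ennreal (m K) + l (V - K)"
          using K V by (intro add_left_mono \<mu>_le open_Diff compact_imp_closed) auto
        also have "\<dots> = (SUP K'\<in>{K'. compact K' \<and> K' \<subseteq> V - K}. ennreal (m K) + ennreal (m K'))"
          unfolding l_def by (intro ennreal_SUP_add_right) auto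
        also have "\<dots> \<le> l V"
        proof (intro SUP_least)
          fix K' assume "K' \<in> {K'. compact K' \<and> K' \<subseteq> V - K}"
          then have K': "compact K'" "K' \<subseteq> V - K" by auto
          have "ennreal (m K) + ennreal (m K') = ennreal (m (K \<union> K'))"
            using K' by (subst add) (auto simp: nonneg)
          also have "\<dots> \<le> l V"
            using K K' by (intro l_upper compact_Un) auto
          finally show "ennreal (m K) + ennreal (m K') \<le> l V" .
        qed
        finally show "ennreal (m K) + \<mu> (V - U) \<le> l V" .
      qed
      finally show "\<mu> (E \<inter> U) + \<mu> (E - U) \<le> l V" .
    qed
  qed
  then have borel_L: "sets borel \<subseteq> L"
    using L unfolding sets_borel measure_space_def
    by (intro sigma_algebra.sigma_sets_subset) auto
  define M where "M = measure_of UNIV (sets (borel :: 'a measure)) \<mu>"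
  have sets_M: "sets M = sets borel"
    using sets.sigma_sets_eq[of "borel :: 'a measure"] by (simp add: M_def)
  have emeasure_M: "emeasure M E = \<mu> E" if "E \<in> sets borel" for E
    unfolding M_def
  proof (rule emeasure_measure_of_sigma[OF _ _ _ that])
    show "sigma_algebra UNIV (sets (borel :: 'a measure))"
      using sets.sigma_algebra_axioms[of borel] by simp
    show "positive (sets borel) \<mu>" using pos by (simp add: positive_def)
    have "countably_additive L \<mu>" using L by (simp add: measure_space_def)
    then show "countably_additive (sets borel) \<mu>"
      using borel_L unfolding countably_additive_def by (metis (no_types, lifting) subset_trans subsetD)
  qed
  show thesis
  proof
    show "emeasure M U \<le> ennreal (m U)" if "open U" for U
      using that l_m by (simp add: emeasure_M \<mu>_open)
    show "ennreal (m K) \<le> emeasure M K" if "compact K" for K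
      using that unfolding emeasure_M[OF borel_compact[OF that]] \<mu>_def
      by (auto intro!: INF_greatest l_upper)
  qed (rule sets_M)
qed

section \<open>Representation of functionals on continuous functions\<close>

lemma C0D:
  assumes "f \<in> C0 S"
  shows "continuous_on S f" "x \<notin> S \<Longrightarrow> f x = 0"
    "0 < e \<Longrightarrow> \<exists>K. compact K \<and> K \<subseteq> S \<and> (\<forall>x\<in>S - K. \<bar>f x\<bar> < e)"
  using assms by (auto simp: C0_def)

lemma C0_bounded:
  assumes "f \<in> C0 S"
  obtains B where "0 \<le> B" "\<And>x. \<bar>f x\<bar> \<le> B"
proof -
  obtain K where K: "compact K" "K \<subseteq> S" "\<And>x. x \<in> S - K \<Longrightarrow> \<bar>f x\<bar> < 1"
    using C0D(3)[OF assms, of 1] by auto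
  have "bounded (f ` K)"
    using K C0D(1)[OF assms] by (intro compact_imp_bounded compact_continuous_image) (auto intro: continuous_on_subset)
  then obtain B where B: "\<And>x. x \<in> K \<Longrightarrow> \<bar>f x\<bar> \<le> B"
    by (auto simp: bounded_iff)
  show thesis
  proof (rule that[of "max B 1"])
    show "\<bar>f x\<bar> \<le> max B 1" for x
      using B[of x] K(3)[of x] C0D(2)[OF assms, of x] by (cases "x \<in> K"; cases "x \<in> S") force+
  qed simp
qed

lemma sup_norm_upper:
  assumes "f \<in> C0 S"
  shows "\<bar>f x\<bar> \<le> sup_norm S f" "0 \<le> sup_norm S f"
proof -
  obtain B where B: "0 \<le> B" "\<And>x. \<bar>f x\<bar> \<le> B" using C0_bounded[OF assms] by blast
  have bdd: "bdd_above (insert 0 ((\<lambda>x. \<bar>f x\<bar>) ` S))"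
    using B by (auto intro!: bdd_aboveI[of _ B])
  show *: "0 \<le> sup_norm S f"
    unfolding sup_norm_def by (rule cSup_upper[OF _ bdd]) auto
  show "\<bar>f x\<bar> \<le> sup_norm S f"
  proof (cases "x \<in> S")
    case True
    then show ?thesis unfolding sup_norm_def by (intro cSup_upper[OF _ bdd]) auto
  qed (use * C0D(2)[OF assms] in auto)
qed

lemma sup_norm_least:
  assumes "0 \<le> c" "\<And>x. x \<in> S \<Longrightarrow> \<bar>f x\<bar> \<le> c"
  shows "sup_norm S f \<le> c"
  unfolding sup_norm_def using assms by (intro cSup_least) auto

lemma borel_measurable_C0:
  fixes S :: "'a::topological_space set"
  assumes "closed S" "f \<in> C0 S"
  shows "f \<in> borel_measurable borel"
proof -
  have "(\<lambda>x. indicator S x *\<^sub>R f x) \<in> borel_measurable borel"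
    using assms C0D(1)[OF assms(2)] by (intro borel_measurable_continuous_on_indicator) auto
  also have "(\<lambda>x. indicator S x *\<^sub>R f x) = f"
    using C0D(2)[OF assms(2)] by (auto simp: indicator_def fun_eq_iff)
  finally show ?thesis .
qed

text \<open>Because \<open>t > 0\<close>, the set misses the points outside \<open>S\<close>, where
  \<open>f\<close> is 0, and the points of \<open>S\<close> outside a compact \<open>K\<close>,
  where \<open>f\<close> is small. Continuity on \<open>K\<close> makes it closed.\<close>

lemma compact_C0_superlevel:
  fixes S :: "'a::t2_space set"
  assumes f: "f \<in> C0 S" and t: "0 < t"
  shows "compact {x. t \<le> f x}"
proof -
  obtain K where K: "compact K" "K \<subseteq> S" "\<And>x. x \<in> S - K \<Longrightarrow> \<bar>f x\<bar> < t"
    using C0D(3)[OF f t] by auto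
  have "x \<in> K" if "t \<le> f x" for x
    using K(3)[of x] C0D(2)[OF f, of x] t that by (cases "x \<in> S") force+
  then have "{x. t \<le> f x} = K \<inter> (K \<inter> f -` {t..})" by auto
  moreover have "closed (K \<inter> f -` {t..})"
    using continuous_on_subset[OF C0D(1)[OF f] K(2)] compact_imp_closed[OF K(1)]
    by (rule continuous_closed_preimage) simp
  ultimately show ?thesis using K(1) by (metis compact_Int_closed)
qed

lemma C0_strict_superlevel:
  assumes f: "f \<in> C0 S" and t: "0 \<le> t"
  obtains U where "open U" "{x. t < f x} = U \<inter> S"
proof -
  have "\<exists>A. open A \<and> A \<inter> S = f -` {t<..} \<inter> S"
    using C0D(1)[OF f] unfolding continuous_on_open_invariant by auto
  moreover have "{x. t < f x} = f -` {t<..} \<inter> S"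
    using C0D(2)[OF f] t by (auto simp: not_less) (metis linorder_not_less)
  ultimately show thesis using that by auto
qed

lemma C0_pos_part:
  assumes "f \<in> C0 S"
  shows "(\<lambda>x. max 0 (f x)) \<in> C0 S"
proof -
  have "\<exists>K. compact K \<and> K \<subseteq> S \<and> (\<forall>x\<in>S - K. \<bar>max 0 (f x)\<bar> < e)" if "0 < e" for e
    using C0D(3)[OF assms that] that by (force simp: max_def)
  then show ?thesis
    using C0D(1,2)[OF assms] by (auto simp: C0_def intro!: continuous_intros)
qed

lemma C0_linear_combination:
  assumes f: "f \<in> C0 S" and g: "g \<in> C0 S"
  shows "(\<lambda>x. a * f x + b * g x) \<in> C0 S"
proof -
  have "\<exists>K. compact K \<and> K \<subseteq> S \<and> (\<forall>x\<in>S - K. \<bar>a * f x + b * g x\<bar> < e)" if e: "0 < e" for e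
  proof -
    \<comment> \<open>The \<open>+ 1\<close> keeps the divisor positive for \<open>a = b = 0\<close>
      and makes the final estimate strict.\<close>
    define d where "d = e / (\<bar>a\<bar> + \<bar>b\<bar> + 1)"
    have d: "0 < d" "(\<bar>a\<bar> + \<bar>b\<bar> + 1) * d = e"
      using e by (auto simp: d_def field_simps add_pos_nonneg intro!: divide_pos_pos)
    obtain K K' where K: "compact K" "K \<subseteq> S" "\<And>x. x \<in> S - K \<Longrightarrow> \<bar>f x\<bar> < d"
        "compact K'" "K' \<subseteq> S" "\<And>x. x \<in> S - K' \<Longrightarrow> \<bar>g x\<bar> < d"
      using C0D(3)[OF f d(1)] C0D(3)[OF g d(1)] by metis
    have "\<bar>a * f x + b * g x\<bar> < e" if x: "x \<in> S - (K \<union> K')" for x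
    proof -
      have "\<bar>a * f x + b * g x\<bar> \<le> \<bar>a\<bar> * \<bar>f x\<bar> + \<bar>b\<bar> * \<bar>g x\<bar>"
        by (metis abs_mult abs_triangle_ineq)
      also have "\<dots> \<le> \<bar>a\<bar> * d + \<bar>b\<bar> * d"
        using K(3)[of x] K(6)[of x] x by (intro add_mono mult_left_mono) auto
      also have "\<dots> < e" using d by (simp add: algebra_simps)
      finally show ?thesis .
    qed
    then show ?thesis using K by (intro exI[of _ "K \<union> K'"]) auto
  qed
  then show ?thesis
    using C0D(1,2)[OF f] C0D(1,2)[OF g] by (auto simp: C0_def intro!: continuous_intros)
qed


section \<open>Positive functionals on bounded functions\<close>

definition bounded_functions :: "('i \<Rightarrow> real) set" where
  "bounded_functions = {f. \<exists>B. \<forall>i. \<bar>f i\<bar> \<le> B}"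

lemma bounded_functionsI: "(\<And>i. \<bar>f i\<bar> \<le> B) \<Longrightarrow> f \<in> bounded_functions"
  by (auto simp: bounded_functions_def)

lemma function_space_bounded_functions: "function_space bounded_functions"
proof -
  have "(\<lambda>i. f i + g i) \<in> bounded_functions"
    if fg: "f \<in> bounded_functions" "g \<in> bounded_functions" for f g :: "'i \<Rightarrow> real"
  proof -
    obtain A B where "\<And>i. \<bar>f i\<bar> \<le> A" "\<And>i. \<bar>g i\<bar> \<le> B"
      using fg by (auto simp: bounded_functions_def)
    then show ?thesis
      by (intro bounded_functionsI[of _ "A + B"]) (meson abs_triangle_ineq add_mono order_trans)
  qed
  moreover have "(\<lambda>i. c * f i) \<in> bounded_functions" if f: "f \<in> bounded_functions" for c and f :: "'i \<Rightarrow> real"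
  proof -
    obtain A where "\<And>i. \<bar>f i\<bar> \<le> A"
      using f by (auto simp: bounded_functions_def)
    then show ?thesis
      by (intro bounded_functionsI[of _ "\<bar>c\<bar> * A"]) (auto simp: abs_mult intro: mult_left_mono)
  qed
  ultimately show ?thesis
    by (auto simp: function_space_def intro: bounded_functionsI[of _ 0])
qed

lemma C0_subset_bounded_functions: "C0 S \<subseteq> bounded_functions"
proof
  fix f :: "'a \<Rightarrow> real" assume "f \<in> C0 S"
  then obtain B where "\<And>x. \<bar>f x\<bar> \<le> B" using C0_bounded by blast
  then show "f \<in> bounded_functions" by (rule bounded_functionsI)
qed

text \<open>\<open>P\<close> is a cut at \<open>y\<close>, either \<open>t \<le> y\<close> or
  \<open>t < y\<close>, so that compact and open superlevel sets are handled together. The sum is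
  \<open>e\<close> times the number of levels below the cut. Levels start at \<open>e\<close> rather
  than 0, since compactness of superlevel sets needs a positive level; this costs at most one
  \<open>e\<close> and explains the range \<open>(n + 1) * e\<close> for \<open>n\<close>
  levels.\<close>

lemma sum_indicator_levels:
  fixes y e :: real and P :: "real \<Rightarrow> bool"
  assumes e: "0 \<le> e" and y: "0 \<le> y" and P: "\<And>t. P t \<Longrightarrow> t \<le> y" "\<And>t. t < y \<Longrightarrow> P t"
  shows "(\<Sum>k<n. e * of_bool (P (real (Suc k) * e))) \<le> y"
    and "y \<le> (real n + 1) * e \<Longrightarrow> y \<le> e + (\<Sum>k<n. e * of_bool (P (real (Suc k) * e)))"
proof -
  have upper: "(\<Sum>k<n. e * of_bool (P (real (Suc k) * e))) \<le> real n * e" for n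
    using sum_mono[of "{..<n}" "\<lambda>k. e * of_bool (P (real (Suc k) * e))" "\<lambda>k. e"] e by auto
  show "(\<Sum>k<n. e * of_bool (P (real (Suc k) * e))) \<le> y"
  proof (induction n)
    case (Suc n)
    show ?case
    proof (cases "P (real (Suc n) * e)")
      case True
      from P(1)[OF this] upper[of "Suc n"] show ?thesis by linarith
    qed (use Suc in simp)
  qed (use y in simp)
  show "y \<le> e + (\<Sum>k<n. e * of_bool (P (real (Suc k) * e)))" if "y \<le> (real n + 1) * e"
    using that
  proof (induction n)
    case (Suc n)
    show ?case
    proof (cases "y \<le> (real n + 1) * e")
      case True
      have "0 \<le> e * of_bool (P (real (Suc n) * e))" using e by simp
      with Suc.IH[OF True] show ?thesis by simp
    next
      case False
      have "P (real (Suc k) * e)" if "k < Suc n" for k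
      proof (rule P(2))
        have "real (Suc k) * e \<le> (real n + 1) * e"
          using that e by (intro mult_right_mono) auto
        then show "real (Suc k) * e < y" using False by linarith
      qed
      then have "(\<Sum>k<Suc n. e * of_bool (P (real (Suc k) * e))) = (\<Sum>k<Suc n. e)"
        by (intro sum.cong) auto
      then show ?thesis using Suc.prems by (simp add: algebra_simps)
    qed
  qed simp
qed

text \<open>Positivity is tested on \<open>S\<close> only, so the set function \<open>m\<close>
  ignores everything outside \<open>S\<close>, and the regularized measure gives the open set
  \<open>- S\<close> mass 0. The mass bound can be strict: a finitely additive \<open>m\<close> may
  have mass at infinity that no function in \<open>C0 S\<close> detects.\<close>

lemma positive_functional_representation:
  fixes S :: "'a::metric_space set"
  assumes S: "closed S" and lin: "linear_on_space bounded_functions \<Lambda>"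
    and pos: "\<And>f. f \<in> bounded_functions \<Longrightarrow> (\<And>x. x \<in> S \<Longrightarrow> 0 \<le> f x) \<Longrightarrow> 0 \<le> \<Lambda> f"
  obtains M where "sets M = borel_sets S" "finite_measure M" "measure M S \<le> \<Lambda> (\<lambda>x. 1)"
    "\<And>f. f \<in> C0 S \<Longrightarrow> \<Lambda> f = integral\<^sup>L M f"
proof -
  note V = function_spaceD[OF function_space_bounded_functions]
  have L_add: "\<Lambda> (\<lambda>i. f i + g i) = \<Lambda> f + \<Lambda> g"
    if "f \<in> bounded_functions" "g \<in> bounded_functions" for f g
    using lin that by (auto simp: linear_on_space_def)
  have L_mult: "\<Lambda> (\<lambda>i. c * f i) = c * \<Lambda> f" if "f \<in> bounded_functions" for c f
    using lin that by (auto simp: linear_on_space_def)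
  have L_minus: "\<Lambda> (\<lambda>i. f i - g i) = \<Lambda> f - \<Lambda> g"
    if "f \<in> bounded_functions" "g \<in> bounded_functions" for f g
    using L_add[OF that(1) V(4)[OF that(2)]] L_mult[OF that(2), of "-1"] by simp
  have L_mono: "\<Lambda> f \<le> \<Lambda> g"
    if "f \<in> bounded_functions" "g \<in> bounded_functions" "\<And>x. x \<in> S \<Longrightarrow> f x \<le> g x" for f g
    using pos[OF V(5)[OF that(2,1)]] L_minus[OF that(2,1)] that(3) by simp
  define m where "m E = \<Lambda> (indicator E)" for E
  have ind: "indicator E \<in> bounded_functions" for E :: "'a set"
    by (rule bounded_functionsI[of _ 1]) (simp add: indicator_def)
  have m_nonneg: "0 \<le> m E" for E
    unfolding m_def by (intro pos ind) simp
  have m_add: "m (E \<union> F) = m E + m F" if "E \<inter> F = {}" for E F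
  proof -
    have "indicator (E \<union> F) = (\<lambda>x. indicator E x + indicator F x :: real)"
      using that by (auto simp: indicator_def fun_eq_iff)
    then show ?thesis unfolding m_def by (simp add: L_add ind)
  qed
  have m_mono: "m E \<le> m F" if "E \<inter> S \<subseteq> F" for E F
    unfolding m_def using that by (intro L_mono ind) (auto simp: indicator_def)
  have m_levels: "(\<lambda>x. \<Sum>k<n. e * of_bool (P k x)) \<in> bounded_functions \<and>
      \<Lambda> (\<lambda>x. \<Sum>k<n. e * of_bool (P k x)) = (\<Sum>k<n. e * m {x. P k x})" for n e and P :: "nat \<Rightarrow> 'a \<Rightarrow> bool"
  proof (induction n)
    case 0
    show ?case using V(1) L_mult[OF V(1), of 0] by simp
  next
    case (Suc n)
    have b: "(\<lambda>x. e * of_bool (P n x)) \<in> bounded_functions"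
        "\<Lambda> (\<lambda>x. e * of_bool (P n x)) = e * m {x. P n x}"
      using V(3)[OF ind, of e "{x. P n x}"] L_mult[OF ind, of e "{x. P n x}"]
      by (simp_all add: m_def indicator_def)
    note a = Suc.IH[THEN conjunct1] Suc.IH[THEN conjunct2]
    show ?case
      unfolding sum.lessThan_Suc using V(2)[OF a(1) b(1)] L_add[OF a(1) b(1)]
      by (simp only: a(2) b(2) simp_thms)
  qed
  obtain M' where M': "sets M' = sets borel" "\<And>U. open U \<Longrightarrow> emeasure M' U \<le> ennreal (m U)"
    "\<And>K. compact K \<Longrightarrow> ennreal (m K) \<le> emeasure M' K"
    using finitely_additive_regularization[of m] m_nonneg m_add by blast
  have space_M': "space M' = UNIV"
    using sets_eq_imp_space_eq[OF M'(1)] by simp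
  interpret M': finite_measure M'
    using M'(2)[of UNIV] by (intro finite_measureI) (auto simp: space_M' top_unique)
  have U_le: "measure M' U \<le> m U" if "open U" for U
    using M'(2)[OF that] m_nonneg[of U] by (simp add: M'.emeasure_eq_measure)
  have le_K: "m K \<le> measure M' K" if "compact K" for K
    using M'(3)[OF that] by (simp add: M'.emeasure_eq_measure)
  have S_sets: "S \<in> sets M'" using S M'(1) by simp
  define B where "B = m UNIV"
  have B: "0 \<le> B" "measure M' UNIV \<le> B" "\<Lambda> (\<lambda>x. 1) = B"
    using m_nonneg[of UNIV] U_le[of UNIV] by (auto simp: B_def m_def)
  have outside: "measure M' (- S) = 0"
  proof -
    have "measure M' (- S) \<le> m (- S)" using S by (intro U_le) auto
    also have "\<dots> \<le> m {}" by (intro m_mono) auto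
    also have "m {} = 0" using m_add[of "{}" "{}"] by simp
    finally show ?thesis by (simp add: measure_le_0_iff)
  qed
  \<comment> \<open>Layer cake: \<open>m\<close> dominates \<open>M'\<close> on the open sets \<open>{f > t}\<close> and is dominated by it on the compact
    sets \<open>{f \<ge> t}\<close>, which gives the two inequalities.\<close>
  have nonneg_case: "\<Lambda> f = integral\<^sup>L M' f" if f: "f \<in> C0 S" and f0: "\<And>x. 0 \<le> f x" for f
  proof -
    obtain b where b: "0 \<le> b" "\<And>x. \<bar>f x\<bar> \<le> b" using C0_bounded[OF f] by blast
    have fb: "f \<in> bounded_functions" using b(2) by (rule bounded_functionsI)
    have fm: "f \<in> borel_measurable M'"
      using borel_measurable_C0[OF S f] M'(1) measurable_cong_sets by blast
    have f_int: "integrable M' f"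
      using b by (intro M'.integrable_const_bound[where B=b] fm) auto
    have int_levels: "integrable M' (\<lambda>x. \<Sum>k<n. e * of_bool (P k x)) \<and>
        integral\<^sup>L M' (\<lambda>x. \<Sum>k<n. e * of_bool (P k x)) = (\<Sum>k<n. e * measure M' {x. P k x})"
      if P: "\<And>k. {x. P k x} \<in> sets borel" for n e and P :: "nat \<Rightarrow> 'a \<Rightarrow> bool"
    proof -
      have eq: "of_bool (P k x) = (indicator {x. P k x} x :: real)" for k x
        by (auto simp: indicator_def)
      have 1: "integrable M' (\<lambda>x. e * of_bool (P k x))" for k
        unfolding eq using P M'(1)
        by (intro integrable_mult_right integrable_real_indicator) (auto simp: M'.emeasure_eq_measure)
      have 2: "integral\<^sup>L M' (\<lambda>x. e * of_bool (P k x)) = e * measure M' {x. P k x}" for k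
        unfolding eq integral_mult_right_zero integral_indicator by (simp add: space_M')
      show ?thesis
        using Bochner_Integration.integrable_sum[OF 1, of "\<lambda>k. k" "{..<n}"]
          Bochner_Integration.integral_sum[OF 1, of "\<lambda>k. k" "{..<n}"]
        by (simp only: 2 simp_thms)
    qed
    have close: "\<bar>\<Lambda> f - integral\<^sup>L M' f\<bar> \<le> e * B" if e: "0 < e" for e
    proof -
      \<comment> \<open>Enough levels of height \<open>e\<close> to pass the bound \<open>b\<close>
        of \<open>f\<close>, so that the step functions are within \<open>e\<close> of
        \<open>f\<close> everywhere.\<close>
      obtain n where n: "b / e < real n" using reals_Archimedean2 by blast
      then have fn: "f x \<le> (real n + 1) * e" for x
        using b(2)[of x] f0[of x] e by (simp add: field_simps)
      have ge_sets: "{x. real (Suc k) * e \<le> f x} \<in> sets borel" for k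
        using compact_C0_superlevel[OF f] e by (intro borel_compact) auto
      have gt_sets: "{x. real (Suc k) * e < f x} \<in> sets borel" for k
        using borel_measurable_C0[OF S f] by simp
      note ge_int = int_levels[where P="\<lambda>k x. real (Suc k) * e \<le> f x" and e=e and n=n, OF ge_sets]
      note gt_int = int_levels[where P="\<lambda>k x. real (Suc k) * e < f x" and e=e and n=n, OF gt_sets]
      let ?s = "\<lambda>x. \<Sum>k<n. e * of_bool (real (Suc k) * e \<le> f x)"
      let ?t = "\<lambda>x. \<Sum>k<n. e * of_bool (real (Suc k) * e < f x)"
      have s: "?s x \<le> f x" "f x \<le> e + ?s x" for x
        by (rule sum_indicator_levels[where P="\<lambda>t. t \<le> f x"]; use e f0 fn in simp)+
      have t: "?t x \<le> f x" "f x \<le> e + ?t x" for x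
        by (rule sum_indicator_levels[where P="\<lambda>t. t < f x"]; use e f0 fn in simp)+
      have const: "(\<lambda>x. e * 1) \<in> bounded_functions" "\<Lambda> (\<lambda>x. e * 1) = e * B"
        using V(3)[OF bounded_functionsI[of "\<lambda>x. 1" 1]] L_mult[OF bounded_functionsI[of "\<lambda>x. 1" 1]] B(3)
        by auto
      have "\<Lambda> f \<le> \<Lambda> (\<lambda>x. e * 1 + ?s x)"
        using const m_levels s by (intro L_mono V(2) fb) auto
      also have "\<dots> = e * B + (\<Sum>k<n. e * m {x. real (Suc k) * e \<le> f x})"
        using const m_levels[where e=e and n=n and P="\<lambda>k x. real (Suc k) * e \<le> f x"]
        by (subst L_add) auto
      also have "\<dots> \<le> e * B + (\<Sum>k<n. e * measure M' {x. real (Suc k) * e \<le> f x})"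
        using e by (intro add_left_mono sum_mono mult_left_mono le_K compact_C0_superlevel[OF f]) auto
      also have "(\<Sum>k<n. e * measure M' {x. real (Suc k) * e \<le> f x}) = integral\<^sup>L M' ?s"
        using ge_int by simp
      also have "\<dots> \<le> integral\<^sup>L M' f"
        using ge_int s by (intro integral_mono f_int) auto
      finally have le: "\<Lambda> f \<le> e * B + integral\<^sup>L M' f" by simp
      \<comment> \<open>The level set is only relatively open. The comparison is made on an open
        \<open>U\<close> cutting it out of \<open>S\<close>, and \<open>m\<close> cannot tell
        \<open>U\<close> from \<open>U \<inter> S\<close>.\<close>
      have m_gt: "measure M' {x. real (Suc k) * e < f x} \<le> m {x. real (Suc k) * e < f x}" for k
      proof -
        obtain U where U: "open U" "{x. real (Suc k) * e < f x} = U \<inter> S"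
          using C0_strict_superlevel[OF f, of "real (Suc k) * e"] e by auto
        have "measure M' (U \<inter> S) \<le> measure M' U"
          using U(1) M'(1) by (intro M'.finite_measure_mono) auto
        also have "\<dots> \<le> m U" using U(1) by (rule U_le)
        also have "\<dots> \<le> m (U \<inter> S)" by (intro m_mono) auto
        finally show ?thesis using U(2) by simp
      qed
      have "integral\<^sup>L M' f \<le> integral\<^sup>L M' (\<lambda>x. e + ?t x)"
        using gt_int t by (intro integral_mono f_int Bochner_Integration.integrable_add) auto
      also have "\<dots> = e * measure M' UNIV + (\<Sum>k<n. e * measure M' {x. real (Suc k) * e < f x})"
        using gt_int by (subst Bochner_Integration.integral_add) (auto simp: space_M')
      also have "\<dots> \<le> e * B + (\<Sum>k<n. e * m {x. real (Suc k) * e < f x})"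
        using e B m_gt by (intro add_mono sum_mono mult_left_mono) auto
      also have "(\<Sum>k<n. e * m {x. real (Suc k) * e < f x}) = \<Lambda> ?t"
        using m_levels[where e=e and n=n and P="\<lambda>k x. real (Suc k) * e < f x"] by simp
      also have "\<dots> \<le> \<Lambda> f"
        using m_levels t by (intro L_mono fb) auto
      finally show ?thesis using le by simp
    qed
    \<comment> \<open>Here \<open>close\<close> is used with \<open>e = d / (B + 1)\<close>, where
      the 1 covers \<open>B = 0\<close>.\<close>
    have "\<bar>\<Lambda> f - integral\<^sup>L M' f\<bar> \<le> 0 + d" if d: "0 < d" for d
    proof -
      have "\<bar>\<Lambda> f - integral\<^sup>L M' f\<bar> \<le> d / (B + 1) * B"
        using d B by (intro close) auto
      also have "\<dots> \<le> d" using d B by (simp add: field_simps)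
      finally show ?thesis by simp
    qed
    then have "\<bar>\<Lambda> f - integral\<^sup>L M' f\<bar> \<le> 0" by (rule field_le_epsilon)
    then show ?thesis by simp
  qed
  have rep: "\<Lambda> f = integral\<^sup>L M' f" if f: "f \<in> C0 S" for f
  proof -
    let ?p = "\<lambda>x. max 0 (f x)" and ?n = "\<lambda>x. max 0 (- f x)"
    have "(\<lambda>x. - f x) \<in> C0 S" using C0_linear_combination[OF f f, of "-1" 0] by simp
    from C0_pos_part[OF f] C0_pos_part[OF this] have pn: "?p \<in> C0 S" "?n \<in> C0 S" .
    have int: "integrable M' g" if g: "g \<in> C0 S" for g
    proof -
      obtain b where "\<And>x. \<bar>g x\<bar> \<le> b" using C0_bounded[OF g] by blast
      moreover have "g \<in> borel_measurable M'"
        using borel_measurable_C0[OF S g] M'(1) measurable_cong_sets by blast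
      ultimately show ?thesis by (intro M'.integrable_const_bound[where B=b]) auto
    qed
    have f_eq: "f = (\<lambda>x. ?p x - ?n x)" by (auto simp: max_def)
    have "\<Lambda> f = \<Lambda> ?p - \<Lambda> ?n"
      using L_minus[of ?p ?n] pn C0_subset_bounded_functions[of S] f_eq by (metis subsetD)
    also have "\<dots> = integral\<^sup>L M' ?p - integral\<^sup>L M' ?n"
      using pn by (simp add: nonneg_case)
    also have "\<dots> = integral\<^sup>L M' (\<lambda>x. ?p x - ?n x)"
      using pn by (intro Bochner_Integration.integral_diff[symmetric] int)
    also have "\<dots> = integral\<^sup>L M' f" using f_eq by metis
    finally show ?thesis .
  qed
  show thesis
  proof
    show "sets (restrict_space M' S) = borel_sets S"
      using M'(1) by (rule sets_restrict_space_cong)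
    show "finite_measure (restrict_space M' S)"
      using S_sets M'.emeasure_finite[of S]
      by (intro finite_measureI) (auto simp: space_M' emeasure_restrict_space space_restrict_space)
    have "measure (restrict_space M' S) S = measure M' S"
      using S_sets by (intro measure_restrict_space) (auto simp: space_M')
    also have "\<dots> \<le> measure M' UNIV"
      using M'(1) by (intro M'.finite_measure_mono) auto
    finally show "measure (restrict_space M' S) S \<le> \<Lambda> (\<lambda>x. 1)" using B by simp
    fix f assume f: "f \<in> C0 S"
    have "integral\<^sup>L (restrict_space M' S) f = integral\<^sup>L M' (\<lambda>x. indicator S x *\<^sub>R f x)"
      using S_sets by (intro integral_restrict_space) (simp add: space_M')
    also have "(\<lambda>x. indicator S x *\<^sub>R f x) = f"
      using C0D(2)[OF f] by (auto simp: indicator_def fun_eq_iff)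
    finally show "\<Lambda> f = integral\<^sup>L (restrict_space M' S) f" using rep[OF f] by simp
  qed
qed


section \<open>Signed functionals on subspaces of \<open>C0\<close>\<close>

definition pos_sup :: "'i set \<Rightarrow> ('i \<Rightarrow> real) \<Rightarrow> real" where
  "pos_sup T f = Sup (insert 0 (f ` T))"

lemma pos_sup_upper:
  assumes "f \<in> bounded_functions"
  shows "x \<in> T \<Longrightarrow> f x \<le> pos_sup T f" "0 \<le> pos_sup T f"
proof -
  obtain B where B: "\<And>x. \<bar>f x\<bar> \<le> B" using assms by (auto simp: bounded_functions_def)
  have "f x \<le> B" "0 \<le> B" for x using B[of x] by linarith+
  then have bdd: "bdd_above (insert 0 (f ` T))" by (auto intro!: bdd_aboveI[of _ B])
  show "x \<in> T \<Longrightarrow> f x \<le> pos_sup T f" "0 \<le> pos_sup T f"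
    unfolding pos_sup_def by (auto intro: cSup_upper[OF _ bdd])
qed

lemma pos_sup_least:
  assumes "0 \<le> c" "\<And>x. x \<in> T \<Longrightarrow> f x \<le> c"
  shows "pos_sup T f \<le> c"
  unfolding pos_sup_def using assms by (intro cSup_least) auto

lemma sublinear_on_pos_sup:
  assumes C: "0 \<le> C"
  shows "sublinear_on bounded_functions (\<lambda>f. C * pos_sup T f)"
  unfolding sublinear_on_def
proof (intro conjI ballI allI impI)
  fix f g :: "'a \<Rightarrow> real" assume fg: "f \<in> bounded_functions" "g \<in> bounded_functions"
  have "pos_sup T (\<lambda>i. f i + g i) \<le> pos_sup T f + pos_sup T g"
    by (intro pos_sup_least add_nonneg_nonneg add_mono pos_sup_upper fg)
  then have "C * pos_sup T (\<lambda>i. f i + g i) \<le> C * (pos_sup T f + pos_sup T g)"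
    using C by (rule mult_left_mono)
  then show "C * pos_sup T (\<lambda>i. f i + g i) \<le> C * pos_sup T f + C * pos_sup T g"
    by (simp add: distrib_left)
next
  fix c :: real and f :: "'a \<Rightarrow> real" assume c: "0 \<le> c" and f: "f \<in> bounded_functions"
  have "pos_sup T (\<lambda>i. c * f i) \<le> c * pos_sup T f"
    by (intro pos_sup_least mult_nonneg_nonneg mult_left_mono pos_sup_upper f c)
  then have "C * pos_sup T (\<lambda>i. c * f i) \<le> C * (c * pos_sup T f)"
    using C by (rule mult_left_mono)
  then show "C * pos_sup T (\<lambda>i. c * f i) \<le> c * (C * pos_sup T f)"
    by (simp add: ac_simps)
qed

text \<open>
  Extending \<open>(g, -g) \<mapsto> L g\<close> from the doubled domain below \<open>C\<close> times the supremum of the positive part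
  makes the extension positive, so that the Jordan decomposition comes for free.
\<close>

lemma Riesz_representation_subspace:
  fixes S :: "'a::metric_space set"
  assumes S: "closed S" and G: "function_space G" "G \<subseteq> C0 S"
    and L: "linear_on_space G L" "\<And>g. g \<in> G \<Longrightarrow> L g \<le> C * sup_norm S g" and C: "0 \<le> C"
  obtains M N where "sets M = borel_sets S" "finite_measure M" "sets N = borel_sets S" "finite_measure N"
    "measure M S + measure N S \<le> C" "\<And>g. g \<in> G \<Longrightarrow> L g = integral\<^sup>L M g - integral\<^sup>L N g"
proof -
  note G' = function_spaceD[OF G(1)]
  let ?T = "S \<times> (UNIV :: bool set)"
  define D :: "('a \<Rightarrow> real) \<Rightarrow> 'a \<times> bool \<Rightarrow> real" where "D g = (\<lambda>(x, b). if b then g x else - g x)" for g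
  define p :: "('a \<times> bool \<Rightarrow> real) \<Rightarrow> real" where "p f = C * pos_sup ?T f" for f
  define L' where "L' h = L (\<lambda>x. h (x, True))" for h :: "'a \<times> bool \<Rightarrow> real"
  have L'_D: "L' (D g) = L g" for g by (simp add: L'_def D_def)
  have D_add: "(\<lambda>i. D f i + D g i) = D (\<lambda>x. f x + g x)" for f g by (auto simp: D_def)
  have D_mult: "(\<lambda>i. c * D g i) = D (\<lambda>x. c * g x)" for c g by (auto simp: D_def)
  have D_bounded: "D g \<in> bounded_functions" if g: "g \<in> G" for g
  proof -
    obtain B where "\<And>x. \<bar>g x\<bar> \<le> B" using C0_bounded g G(2) by blast
    then show ?thesis by (intro bounded_functionsI[of _ B]) (auto simp: D_def)
  qed
  have space: "function_space (D ` G)"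
    unfolding function_space_def
  proof (intro conjI ballI allI)
    have "(\<lambda>i. 0) = D (\<lambda>i. 0)" by (auto simp: D_def)
    then show "(\<lambda>i. 0) \<in> D ` G" using G'(1) by blast
  qed (auto simp: D_add D_mult G')
  have lin: "linear_on_space (D ` G) L'"
    using L(1) by (auto simp: linear_on_space_def D_add D_mult L'_D)
  have dom: "L' h \<le> p h" if "h \<in> D ` G" for h
  proof -
    obtain g where g: "g \<in> G" "h = D g" using \<open>h \<in> D ` G\<close> by auto
    \<comment> \<open>The two copies of \<open>S\<close> carry \<open>g\<close> and
      \<open>- g\<close>, so the one-sided supremum recovers the absolute value.\<close>
    have "sup_norm S g \<le> pos_sup ?T (D g)"
    proof (rule sup_norm_least)
      fix x assume x: "x \<in> S"
      have "D g (x, True) \<le> pos_sup ?T (D g)" "D g (x, False) \<le> pos_sup ?T (D g)"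
        using x by (auto intro!: pos_sup_upper D_bounded g)
      then show "\<bar>g x\<bar> \<le> pos_sup ?T (D g)" by (auto simp: D_def)
    qed (intro pos_sup_upper D_bounded g)
    then have "C * sup_norm S g \<le> p h"
      unfolding p_def g(2) using C by (rule mult_left_mono)
    with L(2)[OF g(1)] show ?thesis by (simp add: g(2) L'_D)
  qed
  have "D ` G \<subseteq> bounded_functions" using D_bounded by auto
  then obtain q where q: "linear_on_space bounded_functions q"
    "\<And>f. f \<in> bounded_functions \<Longrightarrow> q f \<le> p f" "\<And>f. f \<in> D ` G \<Longrightarrow> q f = L' f"
    using Hahn_Banach_sublinear[OF function_space_bounded_functions sublinear_on_pos_sup[OF C, of ?T]
        space _ lin dom[unfolded p_def]]
    unfolding p_def by blast
  note V = function_spaceD[OF function_space_bounded_functions]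
  have q_mult: "q (\<lambda>i. c * f i) = c * q f" if "f \<in> bounded_functions" for c f
    using q(1) that by (auto simp: linear_on_space_def)
  have q_add: "q (\<lambda>i. f i + g i) = q f + q g" if "f \<in> bounded_functions" "g \<in> bounded_functions" for f g
    using q(1) that by (auto simp: linear_on_space_def)
  \<comment> \<open>If \<open>f \<ge> 0\<close> on \<open>?T\<close>, then
    \<open>pos_sup ?T (- f)\<close> is 0 thanks to the 0 inserted in its definition, and the bound
    at \<open>- f\<close> reads \<open>- q f \<le> 0\<close>.\<close>
  have q_pos: "0 \<le> q f" if f: "f \<in> bounded_functions" "\<And>i. i \<in> ?T \<Longrightarrow> 0 \<le> f i" for f
  proof -
    have "q (\<lambda>i. (-1) * f i) \<le> C * pos_sup ?T (\<lambda>i. (-1) * f i)"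
      by (intro q(2)[unfolded p_def] V(3) f(1))
    also have "\<dots> \<le> C * 0"
      using f(2) by (intro mult_left_mono pos_sup_least C) auto
    finally show ?thesis using q_mult[OF f(1), of "-1"] by simp
  qed
  \<comment> \<open>\<open>E c f\<close> puts \<open>f\<close> on copy \<open>c\<close> and 0 on the
    other. From \<open>D g = E True g - E False g\<close> the two copies supply the two measures,
    and \<open>E True 1 + E False 1 = 1\<close> bounds the sum of their masses by
    \<open>q 1 \<le> C\<close>.\<close>
  define E where "E c f = (\<lambda>(x, b). if b = c then f x else 0)" for c :: bool and f :: "'a \<Rightarrow> real"
  have E_bounded: "E c f \<in> bounded_functions" if f: "f \<in> bounded_functions" for c f
  proof -
    obtain B where B: "\<And>x. \<bar>f x\<bar> \<le> B" using f by (auto simp: bounded_functions_def)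
    then have "0 \<le> B" by (meson abs_ge_zero order_trans)
    with B show ?thesis by (intro bounded_functionsI[of _ B]) (auto simp: E_def)
  qed
  have E_add: "E c (\<lambda>i. f i + g i) = (\<lambda>i. E c f i + E c g i)" for c f g by (auto simp: E_def)
  have E_mult: "E c (\<lambda>i. a * f i) = (\<lambda>i. a * E c f i)" for a c f by (auto simp: E_def)
  have E_lin: "linear_on_space bounded_functions (\<lambda>f. q (E c f))" for c
    by (auto simp: linear_on_space_def E_add E_mult q_add q_mult E_bounded)
  have E_pos: "0 \<le> q (E c f)" if "f \<in> bounded_functions" "\<And>x. x \<in> S \<Longrightarrow> 0 \<le> f x" for c f
    using that by (intro q_pos E_bounded) (auto simp: E_def)
  obtain M where M: "sets M = borel_sets S" "finite_measure M" "measure M S \<le> q (E True (\<lambda>x. 1))"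
      "\<And>f. f \<in> C0 S \<Longrightarrow> q (E True f) = integral\<^sup>L M f"
    using positive_functional_representation[OF S E_lin[of True] E_pos[of _ True]] by blast
  obtain N where N: "sets N = borel_sets S" "finite_measure N" "measure N S \<le> q (E False (\<lambda>x. 1))"
      "\<And>f. f \<in> C0 S \<Longrightarrow> q (E False f) = integral\<^sup>L N f"
    using positive_functional_representation[OF S E_lin[of False] E_pos[of _ False]] by blast
  show thesis
  proof (rule that[OF M(1,2) N(1,2)])
    have one: "(\<lambda>x. 1) \<in> (bounded_functions :: ('a \<Rightarrow> real) set)"
      "(\<lambda>x. 1) \<in> (bounded_functions :: ('a \<times> bool \<Rightarrow> real) set)"
      by (auto intro: bounded_functionsI[of _ 1])
    have "measure M S + measure N S \<le> q (E True (\<lambda>x. 1)) + q (E False (\<lambda>x. 1))"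
      using M(3) N(3) by simp
    also have "\<dots> = q (\<lambda>i. E True (\<lambda>x. 1) i + E False (\<lambda>x. 1) i)"
      by (intro q_add[symmetric] E_bounded one)
    also have "(\<lambda>i. E True (\<lambda>x. 1) i + E False (\<lambda>x. 1) i) = (\<lambda>i. 1)"
      by (auto simp: E_def)
    also have "q (\<lambda>i. 1) \<le> C * pos_sup ?T (\<lambda>i. 1)"
      using q(2)[OF one(2)] by (simp add: p_def)
    also have "\<dots> \<le> C * 1" by (intro mult_left_mono pos_sup_least C) auto
    finally show "measure M S + measure N S \<le> C" by simp
  next
    fix g assume g: "g \<in> G"
    then have gb: "g \<in> bounded_functions" using G(2) C0_subset_bounded_functions by blast
    have "L g = q (D g)" using q(3) g L'_D by simp
    also have "D g = (\<lambda>i. E True g i + (-1) * E False g i)"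
      by (auto simp: D_def E_def)
    also have "q \<dots> = q (E True g) + q (\<lambda>i. (-1) * E False g i)"
      by (intro q_add V(3) E_bounded gb)
    also have "q (\<lambda>i. (-1) * E False g i) = (-1) * q (E False g)"
      by (intro q_mult E_bounded gb)
    also have "q (E True g) + \<dots> = integral\<^sup>L M g - integral\<^sup>L N g"
      using M(4) N(4) g G(2) by auto
    finally show "L g = integral\<^sup>L M g - integral\<^sup>L N g" .
  qed
qed

section \<open>The variation of a signed measure\<close>

lemma signed_measureD:
  fixes S :: "'a::topological_space set"
  assumes "signed_measure S \<sigma>"
  shows "E \<notin> borel_sets S \<Longrightarrow> \<sigma> E = 0" "\<sigma> {} = 0"
    "range A \<subseteq> borel_sets S \<Longrightarrow> disjoint_family A \<Longrightarrow> (\<lambda>n. \<sigma> (A n)) sums \<sigma> (\<Union>n. A n)"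
  using assms unfolding signed_measure_def by blast+

lemma variation_upper:
  assumes "range A \<subseteq> borel_sets S" "disjoint_family A" "(\<Union>n. A n) = E"
  shows "(\<Sum>n. ennreal \<bar>\<sigma> (A n)\<bar>) \<le> variation S \<sigma> E"
  unfolding variation_def using assms by (intro SUP_upper) auto

lemma variation_least:
  fixes S :: "'a::topological_space set"
  assumes "\<And>A :: nat \<Rightarrow> 'a set. range A \<subseteq> borel_sets S \<Longrightarrow> disjoint_family A \<Longrightarrow> (\<Union>n. A n) = E \<Longrightarrow>
    (\<Sum>n. ennreal \<bar>\<sigma> (A n)\<bar>) \<le> c"
  shows "variation S \<sigma> E \<le> c"
  unfolding variation_def using assms by (intro SUP_least) auto

lemma variation_uminus [simp]: "variation S (\<lambda>E. - \<sigma> E) = variation S \<sigma>"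
  by (simp add: variation_def fun_eq_iff)

lemma disjoint_family_binaryset: "E \<inter> F = {} \<Longrightarrow> disjoint_family (binaryset E F)"
  by (auto simp: disjoint_family_on_def binaryset_def)

lemma abs_le_variation:
  assumes "E \<in> borel_sets S"
  shows "ennreal \<bar>\<sigma> E\<bar> \<le> variation S \<sigma> E"
proof -
  have "ennreal \<bar>\<sigma> E\<bar> = (\<Sum>n\<in>{0}. ennreal \<bar>\<sigma> (binaryset E {} n)\<bar>)"
    by (simp add: binaryset_def)
  also have "\<dots> \<le> (\<Sum>n. ennreal \<bar>\<sigma> (binaryset E {} n)\<bar>)"
    by (intro sum_le_suminf) auto
  also have "\<dots> \<le> variation S \<sigma> E"
    using assms by (intro variation_upper disjoint_family_binaryset)
      (auto simp: range_binaryset_eq UN_binaryset_eq)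
  finally show ?thesis .
qed

lemma ennreal_abs_sums_le:
  assumes "f sums (s :: real)"
  shows "ennreal \<bar>s\<bar> \<le> (\<Sum>n. ennreal \<bar>f n\<bar>)"
proof (cases "(\<Sum>n. ennreal \<bar>f n\<bar>) = top")
  case False
  then have sm: "summable (\<lambda>n. \<bar>f n\<bar>)"
    by (intro summable_suminf_not_top) auto
  have "\<bar>s\<bar> \<le> (\<Sum>n. \<bar>f n\<bar>)"
    using summable_rabs[OF sm] sums_unique[OF assms] by simp
  then show ?thesis using sm by (simp add: suminf_ennreal2)
qed simp

lemma suminf_swap_ennreal:
  fixes f :: "nat \<Rightarrow> nat \<Rightarrow> ennreal"
  shows "(\<Sum>i. \<Sum>j. f i j) = (\<Sum>j. \<Sum>i. f i j)"
  using nn_integral_suminf[of "\<lambda>j i. f i j" "count_space UNIV"]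
  by (simp add: nn_integral_count_space_nat)

lemma variation_empty: "signed_measure S \<sigma> \<Longrightarrow> variation S \<sigma> {} = 0"
proof -
  assume "signed_measure S \<sigma>"
  then have "variation S \<sigma> {} \<le> 0"
    by (intro variation_least) (auto simp: signed_measureD(2))
  then show ?thesis by simp
qed

text \<open>Partitions of \<open>E\<close> and \<open>F\<close> are glued to one of
  \<open>E \<union> F\<close>. To stay indexed by the naturals, they become rows 0 and 1 of a double
  array with all other rows empty, enumerated by \<open>prod_decode\<close>.\<close>

lemma variation_superadditive:
  fixes S :: "'a::topological_space set"
  assumes s: "signed_measure S \<sigma>" and EF: "E \<inter> F = {}" "E \<in> borel_sets S" "F \<in> borel_sets S"
  shows "variation S \<sigma> E + variation S \<sigma> F \<le> variation S \<sigma> (E \<union> F)"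
proof -
  let ?P = "\<lambda>E. {A :: nat \<Rightarrow> 'a set. range A \<subseteq> borel_sets S \<and> disjoint_family A \<and> (\<Union>n. A n) = E}"
  have *: "(\<Sum>n. ennreal \<bar>\<sigma> (A n)\<bar>) + (\<Sum>n. ennreal \<bar>\<sigma> (B n)\<bar>) \<le> variation S \<sigma> (E \<union> F)"
    if A: "A \<in> ?P E" and B: "B \<in> ?P F" for A B
  proof -
    define G where "G = (\<lambda>(m, n). if m = 0 then A n else if m = (1::nat) then B n else {})"
    let ?C = "\<lambda>i. G (prod_decode i)"
    have G: "G p \<in> borel_sets S" for p
      using A B by (cases p) (auto simp: G_def)
    have G_disj: "G p \<inter> G q = {}" if "p \<noteq> q" for p q
    proof -
      have "A n \<inter> A k = {}" "B n \<inter> B k = {}" if "n \<noteq> k" for n k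
        using A B that by (auto simp: disjoint_family_on_def)
      moreover have "A n \<inter> B k = {}" "B k \<inter> A n = {}" for n k using A B EF(1) by auto
      ultimately show ?thesis using that by (cases p; cases q) (auto simp: G_def)
    qed
    have C: "range ?C \<subseteq> borel_sets S" using G by blast
    have C_disj: "disjoint_family ?C"
      unfolding disjoint_family_on_def
      using inj_onD[OF inj_prod_decode[of UNIV]] by (intro ballI impI G_disj) blast
    have "(\<Union>i. ?C i) = (\<Union>p. G p)"
      using surj_prod_decode by (metis (no_types) image_image)
    also have "\<dots> = E \<union> F"
    proof -
      have "(\<Union>p. G p) = (\<Union>n. A n) \<union> (\<Union>n. B n)"
      proof
        show "(\<Union>n. A n) \<union> (\<Union>n. B n) \<subseteq> (\<Union>p. G p)"
        proof -
          have "A n = G (0, n)" "B n = G (1, n)" for n by (auto simp: G_def)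
          then show ?thesis by blast
        qed
      qed (auto simp: G_def split: if_splits)
      then show ?thesis using A B by simp
    qed
    finally have C_UN: "(\<Union>i. ?C i) = E \<union> F" .
    define g where "g m = (\<Sum>n. ennreal \<bar>\<sigma> (G (m, n))\<bar>)" for m
    have "(\<Sum>n. ennreal \<bar>\<sigma> (A n)\<bar>) + (\<Sum>n. ennreal \<bar>\<sigma> (B n)\<bar>) = (\<Sum>m\<in>{0,1}. g m)"
      by (simp add: g_def G_def)
    also have "\<dots> \<le> (\<Sum>m. g m)"
      by (intro sum_le_suminf) auto
    also have "\<dots> = (\<Sum>i. ennreal \<bar>\<sigma> (?C i)\<bar>)"
      by (rule suminf_ennreal_2dimen[symmetric]) (simp add: g_def)
    also have "\<dots> \<le> variation S \<sigma> (E \<union> F)"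
      by (rule variation_upper[OF C C_disj C_UN])
    finally show ?thesis .
  qed
  \<comment> \<open>Moving a constant inside a supremum of extended reals requires a nonempty index
    set.\<close>
  have ne: "?P E \<noteq> {}" if "E \<in> borel_sets S" for E
  proof -
    have "binaryset E {} \<in> ?P E"
      using that by (auto simp: range_binaryset_eq UN_binaryset_eq intro!: disjoint_family_binaryset)
    then show ?thesis by blast
  qed
  have "variation S \<sigma> E + variation S \<sigma> F = (SUP A\<in>?P E. (\<Sum>n. ennreal \<bar>\<sigma> (A n)\<bar>) + variation S \<sigma> F)"
    unfolding variation_def[of S \<sigma> E] by (rule ennreal_SUP_add_left[OF ne[OF EF(2)], symmetric])
  also have "\<dots> \<le> variation S \<sigma> (E \<union> F)"
  proof (rule SUP_least)
    fix A assume A: "A \<in> ?P E"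
    have "(\<Sum>n. ennreal \<bar>\<sigma> (A n)\<bar>) + variation S \<sigma> F =
        (SUP B\<in>?P F. (\<Sum>n. ennreal \<bar>\<sigma> (A n)\<bar>) + (\<Sum>n. ennreal \<bar>\<sigma> (B n)\<bar>))"
      unfolding variation_def[of S \<sigma> F] by (rule ennreal_SUP_add_right[OF ne[OF EF(3)]])
    also have "\<dots> \<le> variation S \<sigma> (E \<union> F)"
      using A by (intro SUP_least *)
    finally show "(\<Sum>n. ennreal \<bar>\<sigma> (A n)\<bar>) + variation S \<sigma> F \<le> variation S \<sigma> (E \<union> F)" .
  qed
  finally show ?thesis .
qed

text \<open>Superadditivity and monotonicity bound the partial sums by the variation of the union.
  Conversely, a partition \<open>A\<close> of the union is refined to the sets
  \<open>A k \<inter> E n\<close>; the triangle inequality for series and an exchange of the two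
  sums regroup it by \<open>n\<close>.\<close>

lemma countably_additive_variation:
  fixes S :: "'a::topological_space set"
  assumes s: "signed_measure S \<sigma>"
  shows "countably_additive (borel_sets S) (variation S \<sigma>)"
proof (rule countably_additiveI)
  fix E :: "nat \<Rightarrow> 'a set" assume E: "range E \<subseteq> borel_sets S" "disjoint_family E" "(\<Union>n. E n) \<in> borel_sets S"
  have E_sets: "E n \<in> borel_sets S" for n using E(1) by auto
  show "(\<Sum>n. variation S \<sigma> (E n)) = variation S \<sigma> (\<Union>n. E n)"
  proof (rule antisym)
    have fin: "(\<Sum>n<N. variation S \<sigma> (E n)) \<le> variation S \<sigma> (\<Union>n<N. E n)" for N
    proof (induction N)
      case (Suc N)
      have "E n \<inter> E N = {}" if "n < N" for n
        using disjoint_family_onD[OF E(2), of n N] that by auto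
      then have "(\<Union>n<N. E n) \<inter> E N = {}" by blast
      then have "variation S \<sigma> (\<Union>n<N. E n) + variation S \<sigma> (E N) \<le>
          variation S \<sigma> ((\<Union>n<N. E n) \<union> E N)"
        using E_sets by (intro variation_superadditive s) auto
      also have "(\<Union>n<N. E n) \<union> E N = (\<Union>n<Suc N. E n)" by (auto simp: less_Suc_eq)
      finally have "variation S \<sigma> (\<Union>n<N. E n) + variation S \<sigma> (E N) \<le> variation S \<sigma> (\<Union>n<Suc N. E n)" .
      then show ?case
        using order_trans[OF add_right_mono[OF Suc, of "variation S \<sigma> (E N)"]] by simp
    qed simp
    have "variation S \<sigma> (\<Union>n<N. E n) \<le> variation S \<sigma> (\<Union>n. E n)" for N
    proof -
      have N_sets: "(\<Union>n<N. E n) \<in> borel_sets S" using E_sets by auto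
      have "variation S \<sigma> (\<Union>n<N. E n) \<le> variation S \<sigma> (\<Union>n<N. E n) + variation S \<sigma> ((\<Union>n. E n) - (\<Union>n<N. E n))"
        by simp
      also have "\<dots> \<le> variation S \<sigma> ((\<Union>n<N. E n) \<union> ((\<Union>n. E n) - (\<Union>n<N. E n)))"
        using N_sets E(3) by (intro variation_superadditive s) auto
      also have "(\<Union>n<N. E n) \<union> ((\<Union>n. E n) - (\<Union>n<N. E n)) = (\<Union>n. E n)" by auto
      finally show ?thesis .
    qed
    with fin show "(\<Sum>n. variation S \<sigma> (E n)) \<le> variation S \<sigma> (\<Union>n. E n)"
      unfolding suminf_eq_SUP by (intro SUP_least) (blast intro: order_trans)
  next
    show "variation S \<sigma> (\<Union>n. E n) \<le> (\<Sum>n. variation S \<sigma> (E n))"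
    proof (rule variation_least)
      fix A :: "nat \<Rightarrow> 'a set" assume A: "range A \<subseteq> borel_sets S" "disjoint_family A" "(\<Union>n. A n) = (\<Union>n. E n)"
      have AE: "A k \<inter> E n \<in> borel_sets S" for k n using A(1) E_sets by (intro sets.Int) auto
      have "(\<lambda>n. \<sigma> (A k \<inter> E n)) sums \<sigma> (A k)" for k
      proof -
        have "(\<lambda>n. \<sigma> (A k \<inter> E n)) sums \<sigma> (\<Union>n. A k \<inter> E n)"
          using AE disjoint_family_onD[OF E(2)]
          by (intro signed_measureD(3)[OF s]) (auto simp: disjoint_family_on_def, blast)
        also have "(\<Union>n. A k \<inter> E n) = A k" using A(3) by auto
        finally show ?thesis .
      qed
      then have "(\<Sum>k. ennreal \<bar>\<sigma> (A k)\<bar>) \<le> (\<Sum>k. \<Sum>n. ennreal \<bar>\<sigma> (A k \<inter> E n)\<bar>)"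
        by (intro suminf_le ennreal_abs_sums_le) auto
      also have "\<dots> = (\<Sum>n. \<Sum>k. ennreal \<bar>\<sigma> (A k \<inter> E n)\<bar>)"
        by (rule suminf_swap_ennreal)
      also have "\<dots> \<le> (\<Sum>n. variation S \<sigma> (E n))"
      proof (intro suminf_le variation_upper)
        fix n
        show "range (\<lambda>k. A k \<inter> E n) \<subseteq> borel_sets S" using AE by auto
        show "disjoint_family (\<lambda>k. A k \<inter> E n)" using A(2) by (auto simp: disjoint_family_on_def)
        show "(\<Union>k. A k \<inter> E n) = E n" using A(3) by auto
      qed auto
      finally show "(\<Sum>k. ennreal \<bar>\<sigma> (A k)\<bar>) \<le> (\<Sum>n. variation S \<sigma> (E n))" .
    qed
  qed
qed

section \<open>The variation measure, Jordan parts and regularity\<close>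

definition variation_measure :: "'a::topological_space set \<Rightarrow> ('a set \<Rightarrow> real) \<Rightarrow> 'a measure" where
  "variation_measure S \<sigma> = measure_of S (borel_sets S) (variation S \<sigma>)"

text \<open>The working form of \<open>radon_measures\<close>, before regularity is established;
  \<open>radon_measures_iff\<close> identifies the two on closed sets.\<close>

definition finite_signed_measure :: "'a::topological_space set \<Rightarrow> ('a set \<Rightarrow> real) \<Rightarrow> bool" where
  "finite_signed_measure S \<sigma> \<longleftrightarrow> signed_measure S \<sigma> \<and> variation S \<sigma> S < \<infinity>"

lemma space_restrict_borel [simp]: "space (restrict_space borel S) = S"
  by (simp add: space_restrict_space)

lemma sigma_algebra_borel_sets: "sigma_algebra S (borel_sets S)"
  using sets.sigma_algebra_axioms[of "restrict_space borel S"] by simp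

lemma in_borel_sets_self: "S \<in> borel_sets S"
  using sets.top[of "restrict_space borel S"] by simp

lemma sets_measure_of_borel_sets: "sets (measure_of S (borel_sets S) \<mu>) = borel_sets S"
  using sets.sigma_sets_eq[of "restrict_space borel S"] sets.space_closed[of "restrict_space borel S"]
  by simp

lemma variation_measure:
  assumes "signed_measure S \<sigma>"
  shows "sets (variation_measure S \<sigma>) = borel_sets S" "space (variation_measure S \<sigma>) = S"
    "E \<in> borel_sets S \<Longrightarrow> emeasure (variation_measure S \<sigma>) E = variation S \<sigma> E"
proof -
  show sets: "sets (variation_measure S \<sigma>) = borel_sets S"
    by (simp only: variation_measure_def sets_measure_of_borel_sets)
  show "space (variation_measure S \<sigma>) = S"
    using sets_eq_imp_space_eq[OF sets] by simp
  show "emeasure (variation_measure S \<sigma>) E = variation S \<sigma> E" if "E \<in> borel_sets S"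
    unfolding variation_measure_def using that assms
    by (intro emeasure_measure_of_sigma sigma_algebra_borel_sets countably_additive_variation)
      (auto simp: positive_def variation_empty)
qed

lemma finite_measure_variation_measure:
  assumes "finite_signed_measure S \<sigma>"
  shows "finite_measure (variation_measure S \<sigma>)"
proof (rule finite_measureI)
  have s: "signed_measure S \<sigma>" and fin: "variation S \<sigma> S < \<infinity>"
    using assms by (auto simp: finite_signed_measure_def)
  show "emeasure (variation_measure S \<sigma>) (space (variation_measure S \<sigma>)) \<noteq> \<infinity>"
    using fin by (simp add: variation_measure(2)[OF s] variation_measure(3)[OF s in_borel_sets_self])
qed

lemma finite_signed_measure_uminus:
  "finite_signed_measure S \<sigma> \<Longrightarrow> finite_signed_measure S (\<lambda>E. - \<sigma> E)"
  by (auto simp: finite_signed_measure_def signed_measure_def intro!: sums_minus)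

text \<open>Nonnegativity is the bound of \<open>\<bar>\<sigma> E\<bar>\<close> by the variation of
  \<open>E\<close>. Since the variation is finite, countable additivity is checked on convergent
  real series and only then moved to \<open>ennreal\<close>.\<close>

lemma positive_part:
  fixes S :: "'a::topological_space set"
  assumes fs: "finite_signed_measure S \<sigma>"
  shows "sets (positive_part S \<sigma>) = borel_sets S" "space (positive_part S \<sigma>) = S"
    "E \<in> borel_sets S \<Longrightarrow> measure (positive_part S \<sigma>) E = (enn2real (variation S \<sigma> E) + \<sigma> E) / 2"
    "finite_measure (positive_part S \<sigma>)"
proof -
  have s: "signed_measure S \<sigma>" using fs by (simp add: finite_signed_measure_def)
  interpret V: finite_measure "variation_measure S \<sigma>"
    by (rule finite_measure_variation_measure[OF fs])
  note V = variation_measure[OF s]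
  define p where "p E = (enn2real (variation S \<sigma> E) + \<sigma> E) / 2" for E
  have vr: "enn2real (variation S \<sigma> E) = measure (variation_measure S \<sigma>) E" if "E \<in> borel_sets S" for E
    using V(3)[OF that] by (simp add: measure_def)
  have p_nonneg: "0 \<le> p E" if "E \<in> borel_sets S" for E
  proof -
    have "ennreal \<bar>\<sigma> E\<bar> \<le> ennreal (enn2real (variation S \<sigma> E))"
      using abs_le_variation[OF that, of \<sigma>] V(3)[OF that] vr[OF that] V.emeasure_eq_measure by metis
    then have "\<bar>\<sigma> E\<bar> \<le> enn2real (variation S \<sigma> E)" by simp
    then show ?thesis by (simp add: p_def abs_le_iff)
  qed
  show sets: "sets (positive_part S \<sigma>) = borel_sets S"
    by (simp only: positive_part_def sets_measure_of_borel_sets)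
  show space: "space (positive_part S \<sigma>) = S"
    using sets_eq_imp_space_eq[OF sets] by simp
  have em: "emeasure (positive_part S \<sigma>) E = ennreal (p E)" if "E \<in> borel_sets S" for E
    unfolding positive_part_def p_def[symmetric]
  proof (rule emeasure_measure_of_sigma[OF sigma_algebra_borel_sets _ _ that])
    show "positive (borel_sets S) (\<lambda>E. ennreal (p E))"
      by (simp add: positive_def p_def variation_empty[OF s] signed_measureD(2)[OF s])
    show "countably_additive (borel_sets S) (\<lambda>E. ennreal (p E))"
    proof (rule countably_additiveI)
      fix A :: "nat \<Rightarrow> 'a set" assume A: "range A \<subseteq> borel_sets S" "disjoint_family A" "(\<Union>n. A n) \<in> borel_sets S"
      have "(\<lambda>n. measure (variation_measure S \<sigma>) (A n)) sums measure (variation_measure S \<sigma>) (\<Union>n. A n)"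
        using A V(1) by (intro V.finite_measure_UNION) auto
      then have "(\<lambda>n. enn2real (variation S \<sigma> (A n))) sums enn2real (variation S \<sigma> (\<Union>n. A n))"
        using vr A by (simp add: range_subsetD)
      from sums_divide[OF sums_add[OF this signed_measureD(3)[OF s A(1,2)]], of 2]
      have "(\<lambda>n. p (A n)) sums p (\<Union>n. A n)" by (simp add: p_def)
      then show "(\<Sum>n. ennreal (p (A n))) = ennreal (p (\<Union>n. A n))"
        using A(1) by (intro suminf_ennreal_eq p_nonneg) auto
    qed
  qed
  show "measure (positive_part S \<sigma>) E = (enn2real (variation S \<sigma> E) + \<sigma> E) / 2" if "E \<in> borel_sets S"
    using em[OF that] p_nonneg[OF that] by (simp add: measure_def p_def)
  show "finite_measure (positive_part S \<sigma>)"
    using em[OF in_borel_sets_self] by (intro finite_measureI) (simp add: space)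
qed

lemma Jordan_decomposition:
  assumes fs: "finite_signed_measure S \<sigma>"
  defines "P \<equiv> positive_part S \<sigma>" and "N \<equiv> positive_part S (\<lambda>E. - \<sigma> E)"
  shows "sets P = borel_sets S" "space P = S" "finite_measure P"
    "sets N = borel_sets S" "space N = S" "finite_measure N"
    "E \<in> borel_sets S \<Longrightarrow> \<sigma> E = measure P E - measure N E"
    "measure P S + measure N S = tv_norm S \<sigma>"
    "signed_integral S \<sigma> f = integral\<^sup>L P f - integral\<^sup>L N f"
proof -
  note pos = positive_part[OF fs] and neg = positive_part[OF finite_signed_measure_uminus[OF fs]]
  show "\<sigma> E = measure P E - measure N E" if "E \<in> borel_sets S"
    unfolding P_def N_def pos(3)[OF that] neg(3)[OF that] by (simp add: field_simps)
  show "measure P S + measure N S = tv_norm S \<sigma>"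
    unfolding P_def N_def tv_norm_def pos(3)[OF in_borel_sets_self] neg(3)[OF in_borel_sets_self]
    by (simp add: field_simps)
  show "signed_integral S \<sigma> f = integral\<^sup>L P f - integral\<^sup>L N f"
    by (simp only: signed_integral_def P_def N_def)
  show "sets P = borel_sets S" "space P = S" "finite_measure P"
    "sets N = borel_sets S" "space N = S" "finite_measure N"
    unfolding P_def N_def using pos(1,2,4) neg(1,2,4) by simp_all
qed

lemma borel_sets_closed_iff:
  assumes "closed S"
  shows "E \<in> borel_sets S \<longleftrightarrow> E \<in> sets borel \<and> E \<subseteq> S"
  using assms by (subst sets_restrict_space_iff) auto

text \<open>The variation is pushed forward to a finite Borel measure on the whole complete second
  countable space, where inner and outer regularity hold. Closedness keeps Borel subsets of
  \<open>S\<close> Borel in the whole space, and intersecting with \<open>S\<close> turns the open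
  supersets into relatively open ones.\<close>

lemma regular_finite_signed_measure:
  fixes S :: "'a::{second_countable_topology, complete_space} set"
  assumes S: "closed S" and fs: "finite_signed_measure S \<sigma>"
  shows "regular_signed_measure S \<sigma>"
proof -
  have s: "signed_measure S \<sigma>" using fs by (simp add: finite_signed_measure_def)
  note V = variation_measure[OF s]
  interpret V: finite_measure "variation_measure S \<sigma>"
    by (rule finite_measure_variation_measure[OF fs])
  define M where "M = distr (variation_measure S \<sigma>) borel (\<lambda>x. x)"
  have id: "(\<lambda>x. x) \<in> measurable (variation_measure S \<sigma>) borel"
    using V(1) S by (intro measurableI) (auto simp: borel_sets_closed_iff V(2))
  have M: "emeasure M B = variation S \<sigma> (B \<inter> S)" if "B \<in> sets borel" for B
    unfolding M_def using that S V id
    by (subst emeasure_distr) (auto simp: borel_sets_closed_iff)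
  have sets_M: "sets M = sets borel" by (simp add: M_def)
  have M_fin: "emeasure M (space M) \<noteq> \<infinity>"
    using fs sets_eq_imp_space_eq[OF sets_M] by (auto simp: M finite_signed_measure_def)
  show ?thesis
    unfolding regular_signed_measure_def
  proof (intro ballI conjI)
    fix E assume "E \<in> borel_sets S"
    then have E: "E \<in> sets borel" "E \<subseteq> S" using S by (auto simp: borel_sets_closed_iff)
    then have ME: "emeasure M E = variation S \<sigma> E" by (simp add: M Int_absorb2)
    have "emeasure M E = (SUP K\<in>{K. K \<subseteq> E \<and> compact K}. emeasure M K)"
      by (rule inner_regular[OF sets_M M_fin E(1)])
    also have "\<dots> = (SUP K\<in>{K. compact K \<and> K \<subseteq> E}. variation S \<sigma> K)"
      using E(2) by (intro SUP_cong) (auto simp: M borel_compact Int_absorb2 subset_trans)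
    finally show "variation S \<sigma> E = (SUP K\<in>{K. compact K \<and> K \<subseteq> E}. variation S \<sigma> K)"
      using ME by simp
    have "emeasure M E = (INF U\<in>{U. E \<subseteq> U \<and> open U}. emeasure M U)"
      by (rule outer_regular[OF sets_M M_fin E(1)])
    also have "\<dots> = (INF U\<in>{U. E \<subseteq> U \<and> open U}. variation S \<sigma> (U \<inter> S))"
      by (intro INF_cong) (auto simp: M)
    also have "\<dots> = (INF U\<in>(\<lambda>U. U \<inter> S) ` {U. E \<subseteq> U \<and> open U}. variation S \<sigma> U)"
      by (simp add: image_image)
    also have "(\<lambda>U. U \<inter> S) ` {U. E \<subseteq> U \<and> open U} = {U. openin (top_of_set S) U \<and> E \<subseteq> U}"
      using E(2) by (auto simp: openin_open Int_commute)
    finally show "variation S \<sigma> E = (INF U\<in>{U. openin (top_of_set S) U \<and> E \<subseteq> U}. variation S \<sigma> U)"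
      using ME by simp
  qed
qed

lemma radon_measures_iff:
  fixes S :: "'a::{second_countable_topology, complete_space} set"
  assumes "closed S"
  shows "\<sigma> \<in> radon_measures S \<longleftrightarrow> finite_signed_measure S \<sigma>"
  using regular_finite_signed_measure[OF assms]
  by (auto simp: radon_measures_def finite_signed_measure_def)

text \<open>Only an inequality holds for the norm, because \<open>M\<close> and \<open>N\<close> may
  overlap. It is what bounds the norm of a representing measure by that of the functional.\<close>

lemma finite_signed_measureI_diff:
  fixes S :: "'a::topological_space set"
  assumes M: "sets M = borel_sets S" "finite_measure M" and N: "sets N = borel_sets S" "finite_measure N"
    and \<sigma>: "\<And>E. E \<in> borel_sets S \<Longrightarrow> \<sigma> E = measure M E - measure N E" "\<And>E. E \<notin> borel_sets S \<Longrightarrow> \<sigma> E = 0"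
  shows "finite_signed_measure S \<sigma>" "tv_norm S \<sigma> \<le> measure M S + measure N S"
proof -
  interpret M: finite_measure M by (rule M(2))
  interpret N: finite_measure N by (rule N(2))
  have "variation S \<sigma> S \<le> emeasure M S + emeasure N S"
  proof (rule variation_least)
    fix A :: "nat \<Rightarrow> 'a set" assume A: "range A \<subseteq> borel_sets S" "disjoint_family A" "(\<Union>n. A n) = S"
    have "ennreal \<bar>\<sigma> (A n)\<bar> \<le> emeasure M (A n) + emeasure N (A n)" for n
    proof -
      have "\<bar>measure M (A n) - measure N (A n)\<bar> \<le> measure M (A n) + measure N (A n)"
        using measure_nonneg[of M "A n"] measure_nonneg[of N "A n"] by linarith
      moreover have "\<sigma> (A n) = measure M (A n) - measure N (A n)" using A(1) by (intro \<sigma>) auto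
      ultimately show ?thesis
        by (simp add: M.emeasure_eq_measure N.emeasure_eq_measure flip: ennreal_plus)
    qed
    then have "(\<Sum>n. ennreal \<bar>\<sigma> (A n)\<bar>) \<le> (\<Sum>n. emeasure M (A n) + emeasure N (A n))"
      by (intro suminf_le) auto
    also have "\<dots> = (\<Sum>n. emeasure M (A n)) + (\<Sum>n. emeasure N (A n))"
      by (intro suminf_add[symmetric]) auto
    also have "\<dots> = emeasure M S + emeasure N S"
      using suminf_emeasure[of A M] suminf_emeasure[of A N] A M(1) N(1) by simp
    finally show "(\<Sum>n. ennreal \<bar>\<sigma> (A n)\<bar>) \<le> emeasure M S + emeasure N S" .
  qed
  then have le: "variation S \<sigma> S \<le> ennreal (measure M S + measure N S)"
    by (simp add: M.emeasure_eq_measure N.emeasure_eq_measure)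
  show "tv_norm S \<sigma> \<le> measure M S + measure N S"
    unfolding tv_norm_def by (intro enn2real_leI le add_nonneg_nonneg measure_nonneg)
  have "signed_measure S \<sigma>"
    unfolding signed_measure_def
  proof (intro conjI allI impI)
    fix A :: "nat \<Rightarrow> 'a set" assume A: "range A \<subseteq> borel_sets S" "disjoint_family A"
    then have U: "(\<Union>n. A n) \<in> borel_sets S" by (intro sets.countable_UN) auto
    have "(\<lambda>n. measure M (A n) - measure N (A n)) sums (measure M (\<Union>n. A n) - measure N (\<Union>n. A n))"
      using A M(1) N(1) by (intro sums_diff M.finite_measure_UNION N.finite_measure_UNION) auto
    moreover have "\<sigma> (A n) = measure M (A n) - measure N (A n)" for n
      using A(1) by (intro \<sigma>) auto
    ultimately show "(\<lambda>n. \<sigma> (A n)) sums \<sigma> (\<Union>n. A n)"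
      using \<sigma>(1)[OF U] by simp
  qed (use \<sigma> in auto)
  then show "finite_signed_measure S \<sigma>"
    using le by (auto simp: finite_signed_measure_def intro: le_less_trans)
qed

section \<open>Integration against signed measures\<close>

text \<open>This transfers linear identities between measures to integrals. Real weights allow any
  signs, so one induction over measurable functions serves every identity about signed
  integrals.\<close>

lemma weighted_integral_eq_0:
  fixes M :: "'i \<Rightarrow> 'a measure" and c :: "'i \<Rightarrow> real"
  assumes I: "finite I" and M: "\<And>i. i \<in> I \<Longrightarrow> finite_measure (M i)" "\<And>i. i \<in> I \<Longrightarrow> sets (M i) = sets R"
    and eq: "\<And>E. E \<in> sets R \<Longrightarrow> (\<Sum>i\<in>I. c i * measure (M i) E) = 0"
    and f: "f \<in> borel_measurable R" "\<And>x. \<bar>f x\<bar> \<le> B"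
  shows "(\<Sum>i\<in>I. c i * integral\<^sup>L (M i) f) = 0"
proof -
  have space: "space (M i) = space R" if "i \<in> I" for i
    using M(2)[OF that] by (rule sets_eq_imp_space_eq)
  have meas: "u \<in> borel_measurable (M i)" if "i \<in> I" "u \<in> borel_measurable R" for i and u :: "'a \<Rightarrow> real"
    using that(2) measurable_cong_sets[OF M(2)[OF that(1)] refl] by blast
  have int: "integrable (M i) u"
    if "i \<in> I" "u \<in> borel_measurable R" "\<And>x. x \<in> space R \<Longrightarrow> \<bar>u x\<bar> \<le> b" for i u and b :: real
    using that by (intro finite_measure.integrable_const_bound[OF M(1), of _ _ b] meas AE_I2)
      (auto simp: space)
  \<comment> \<open>The bound is quantified inside the induction claim because it changes on the
    way, for instance to \<open>b / a\<close> under scaling. It supplies integrability in the sum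
    case and a dominating constant in the limit case.\<close>
  have nonneg: "\<forall>b. (\<forall>x\<in>space R. u x \<le> b) \<longrightarrow> (\<Sum>i\<in>I. c i * integral\<^sup>L (M i) u) = 0"
    if "u \<in> borel_measurable R" "\<And>x. 0 \<le> u x" for u
    using that
  proof (induction rule: borel_measurable_induct_real)
    case (set A)
    have "integral\<^sup>L (M i) (indicator A) = measure (M i) A" if "i \<in> I" for i
      using set sets.sets_into_space[OF set] by (simp add: space[OF that] Int_absorb2)
    then show ?case using eq[OF set] by simp
  next
    case (mult u a)
    show ?case
    proof (cases "a = 0")
      case False
      show ?thesis
      proof (intro allI impI)
        fix b assume b: "\<forall>x\<in>space R. a * u x \<le> b"
        have "(\<Sum>i\<in>I. c i * integral\<^sup>L (M i) (\<lambda>x. a * u x)) = a * (\<Sum>i\<in>I. c i * integral\<^sup>L (M i) u)"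
          by (simp add: sum_distrib_left ac_simps)
        moreover have "\<forall>x\<in>space R. u x \<le> b / a"
          using b mult.hyps(1) False by (auto simp: field_simps)
        ultimately show "(\<Sum>i\<in>I. c i * integral\<^sup>L (M i) (\<lambda>x. a * u x)) = 0"
          using mult.IH by auto
      qed
    qed simp
  next
    case (add u v)
    show ?case
    proof (intro allI impI)
      fix b assume b: "\<forall>x\<in>space R. v x + u x \<le> b"
      have ub: "\<forall>x\<in>space R. u x \<le> b" and vb: "\<forall>x\<in>space R. v x \<le> b"
        using b add.hyps(2,4) by (auto intro: order_trans[rotated])
      have "integral\<^sup>L (M i) (\<lambda>x. v x + u x) = integral\<^sup>L (M i) v + integral\<^sup>L (M i) u" if "i \<in> I" for i
        using add.hyps(1-4) ub vb that by (intro Bochner_Integration.integral_add int[of _ _ b]) auto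
      then have "(\<Sum>i\<in>I. c i * integral\<^sup>L (M i) (\<lambda>x. v x + u x)) =
          (\<Sum>i\<in>I. c i * integral\<^sup>L (M i) v) + (\<Sum>i\<in>I. c i * integral\<^sup>L (M i) u)"
        by (simp add: distrib_left sum.distrib)
      then show "(\<Sum>i\<in>I. c i * integral\<^sup>L (M i) (\<lambda>x. v x + u x)) = 0"
        using add.IH ub vb by auto
    qed
  next
    case (seq U)
    show ?case
    proof (intro allI impI)
      fix b assume b: "\<forall>x\<in>space R. u x \<le> b"
      have U_le: "U n x \<le> b" if "x \<in> space R" for n x
      proof -
        have "incseq (\<lambda>n. U n x)" using seq.hyps(3) by (auto simp: incseq_def le_fun_def)
        then have "U n x \<le> u x" using seq.hyps(4)[OF that] by (rule incseq_le)
        then show ?thesis using b that by force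
      qed
      have u: "u \<in> borel_measurable R"
        using seq.hyps(1,4) by (rule borel_measurable_LIMSEQ_metric)
      have "(\<lambda>n. integral\<^sup>L (M i) (U n)) \<longlonglongrightarrow> integral\<^sup>L (M i) u" if i: "i \<in> I" for i
      proof (rule integral_dominated_convergence[where w="\<lambda>_. b"])
        show "integrable (M i) (\<lambda>_. b)" by (intro int[OF i, of _ "\<bar>b\<bar>"]) auto
      qed (use i u seq.hyps U_le that in \<open>auto simp: space meas intro!: AE_I2\<close>)
      then have "(\<lambda>n. \<Sum>i\<in>I. c i * integral\<^sup>L (M i) (U n)) \<longlonglongrightarrow> (\<Sum>i\<in>I. c i * integral\<^sup>L (M i) u)"
        by (intro tendsto_sum tendsto_mult tendsto_const)
      moreover have "(\<Sum>i\<in>I. c i * integral\<^sup>L (M i) (U n)) = 0" for n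
        using seq.IH[of n] U_le by blast
      ultimately show "(\<Sum>i\<in>I. c i * integral\<^sup>L (M i) u) = 0"
        by (simp add: LIMSEQ_const_iff)
    qed
  qed
  \<comment> \<open>Adding \<open>B\<close> makes the integrand nonnegative with bound
    \<open>2 * B\<close>; the constant is then subtracted again.\<close>
  have B: "0 \<le> B" using f(2) abs_ge_zero order_trans by blast
  have "integral\<^sup>L (M i) f = integral\<^sup>L (M i) (\<lambda>x. f x + B) - integral\<^sup>L (M i) (\<lambda>x. B)" if "i \<in> I" for i
  proof -
    have "integral\<^sup>L (M i) (\<lambda>x. f x + B) = integral\<^sup>L (M i) f + integral\<^sup>L (M i) (\<lambda>x. B)"
      using that f B by (intro Bochner_Integration.integral_add int[where b=B]) auto
    then show ?thesis by simp
  qed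
  then have "(\<Sum>i\<in>I. c i * integral\<^sup>L (M i) f) =
      (\<Sum>i\<in>I. c i * integral\<^sup>L (M i) (\<lambda>x. f x + B)) - (\<Sum>i\<in>I. c i * integral\<^sup>L (M i) (\<lambda>x. B))"
    by (simp add: right_diff_distrib sum_subtractf)
  also have "(\<Sum>i\<in>I. c i * integral\<^sup>L (M i) (\<lambda>x. f x + B)) = 0"
  proof -
    have "0 \<le> f x + B" "f x + B \<le> 2 * B" for x using f(2)[of x] by linarith+
    then show ?thesis
      using nonneg[of "\<lambda>x. f x + B", rule_format, of "2 * B"] f(1) by simp
  qed
  also have "(\<Sum>i\<in>I. c i * integral\<^sup>L (M i) (\<lambda>x. B)) = 0"
    using nonneg[of "\<lambda>x. B"] B by auto
  finally show ?thesis by simp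
qed

text \<open>Indexing by list positions lets concrete identities be written out, and a measure that
  occurs twice still counts twice.\<close>

lemma weighted_integral_list_eq_0:
  fixes ms :: "(real \<times> 'a measure) list"
  assumes "\<And>c M. (c, M) \<in> set ms \<Longrightarrow> finite_measure M" "\<And>c M. (c, M) \<in> set ms \<Longrightarrow> sets M = sets R"
    and eq: "\<And>E. E \<in> sets R \<Longrightarrow> (\<Sum>(c, M)\<leftarrow>ms. c * measure M E) = 0"
    and f: "f \<in> borel_measurable R" "\<And>x. \<bar>f x\<bar> \<le> B"
  shows "(\<Sum>(c, M)\<leftarrow>ms. c * integral\<^sup>L M f) = 0"
proof -
  have *: "(\<Sum>(c, M)\<leftarrow>ms. c * F M) = (\<Sum>i<length ms. fst (ms ! i) * F (snd (ms ! i)))" for F :: "_ \<Rightarrow> real"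
    by (simp add: sum_list_sum_nth atLeast0LessThan case_prod_beta)
  show ?thesis
    unfolding *
  proof (rule weighted_integral_eq_0[where R=R])
    show "finite_measure (snd (ms ! i))" "sets (snd (ms ! i)) = sets R" if "i \<in> {..<length ms}" for i
      using assms(1,2)[of "fst (ms ! i)" "snd (ms ! i)"] that by auto
  qed (use eq f in \<open>auto simp: *\<close>)
qed

section \<open>The signed integral on \<open>C0\<close>\<close>

lemma measurable_ident_borel_sets:
  "sets M = borel_sets S \<Longrightarrow> (\<lambda>x. x) \<in> measurable M borel"
  using measurable_cong_sets[of M "restrict_space borel S" borel borel] measurable_restrict_space1[OF measurable_ident]
  by (auto simp: id_def)

lemma C0_borel_measurable:
  fixes S :: "'a::topological_space set"
  assumes "closed S" "sets M = borel_sets S" "f \<in> C0 S"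
  shows "f \<in> borel_measurable M"
  using measurable_compose[OF measurable_ident_borel_sets[OF assms(2)] borel_measurable_C0[OF assms(1,3)]] .

lemma C0_integrable:
  fixes S :: "'a::topological_space set"
  assumes "closed S" "sets M = borel_sets S" "finite_measure M" "f \<in> C0 S"
  shows "integrable M f"
proof -
  obtain B where "\<And>x. \<bar>f x\<bar> \<le> B" using C0_bounded[OF assms(4)] by blast
  then show ?thesis
    using C0_borel_measurable[OF assms(1,2,4)]
    by (intro finite_measure.integrable_const_bound[OF assms(3), of _ B]) auto
qed

text \<open>The signed integral is defined through the Jordan parts, yet any decomposition into
  finite measures computes it: with signs, the four measures cancel on every Borel set.\<close>

lemma signed_integral_diff:
  fixes S :: "'a::topological_space set"
  assumes S: "closed S" and M: "sets M = borel_sets S" "finite_measure M" and N: "sets N = borel_sets S" "finite_measure N"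
    and \<sigma>: "\<And>E. E \<in> borel_sets S \<Longrightarrow> \<sigma> E = measure M E - measure N E" "\<And>E. E \<notin> borel_sets S \<Longrightarrow> \<sigma> E = 0"
    and f: "f \<in> C0 S"
  shows "signed_integral S \<sigma> f = integral\<^sup>L M f - integral\<^sup>L N f"
proof -
  have "finite_signed_measure S \<sigma>"
    by (rule finite_signed_measureI_diff(1)[OF M N]) (use \<sigma> in auto)
  note J = Jordan_decomposition[OF this]
  obtain B where B: "\<And>x. \<bar>f x\<bar> \<le> B" using C0_bounded[OF f] by blast
  let ?P = "positive_part S \<sigma>" and ?N = "positive_part S (\<lambda>E. - \<sigma> E)"
  have "(\<Sum>(c, M)\<leftarrow>[(1, ?P), (-1, ?N), (-1, M), (1, N)]. c * integral\<^sup>L M f) = 0"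
  proof (rule weighted_integral_list_eq_0[where R="restrict_space borel S" and B=B])
    fix E assume E: "E \<in> borel_sets S"
    then show "(\<Sum>(c, M)\<leftarrow>[(1, ?P), (-1, ?N), (-1, M), (1, N)]. c * measure M E) = 0"
      using J(7)[OF E] \<sigma>(1)[OF E] by simp
  qed (use J M N B C0_borel_measurable[OF S refl f] in auto)
  then show ?thesis by (simp add: J(9))
qed

lemma finite_signed_measure_lincomb:
  fixes S :: "'a::topological_space set"
  assumes s: "finite_signed_measure S \<sigma>" and t: "finite_signed_measure S \<tau>"
  shows "finite_signed_measure S (\<lambda>E. a * \<sigma> E + b * \<tau> E)"
proof -
  have st: "signed_measure S \<sigma>" "variation S \<sigma> S < \<infinity>" "signed_measure S \<tau>" "variation S \<tau> S < \<infinity>"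
    using s t by (auto simp: finite_signed_measure_def)
  have "signed_measure S (\<lambda>E. a * \<sigma> E + b * \<tau> E)"
    unfolding signed_measure_def using signed_measureD[OF st(1)] signed_measureD[OF st(3)]
    by (auto intro!: sums_add sums_mult)
  moreover have "variation S (\<lambda>E. a * \<sigma> E + b * \<tau> E) S \<le>
      ennreal \<bar>a\<bar> * variation S \<sigma> S + ennreal \<bar>b\<bar> * variation S \<tau> S"
  proof (rule variation_least)
    fix A :: "nat \<Rightarrow> 'a set" assume A: "range A \<subseteq> borel_sets S" "disjoint_family A" "(\<Union>n. A n) = S"
    have "ennreal \<bar>a * \<sigma> (A n) + b * \<tau> (A n)\<bar> \<le>
        ennreal \<bar>a\<bar> * ennreal \<bar>\<sigma> (A n)\<bar> + ennreal \<bar>b\<bar> * ennreal \<bar>\<tau> (A n)\<bar>" for n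
    proof -
      have "\<bar>a * \<sigma> (A n) + b * \<tau> (A n)\<bar> \<le> \<bar>a\<bar> * \<bar>\<sigma> (A n)\<bar> + \<bar>b\<bar> * \<bar>\<tau> (A n)\<bar>"
        by (metis abs_mult abs_triangle_ineq)
      then show ?thesis by (simp flip: ennreal_mult ennreal_plus)
    qed
    then have "(\<Sum>n. ennreal \<bar>a * \<sigma> (A n) + b * \<tau> (A n)\<bar>) \<le>
        (\<Sum>n. ennreal \<bar>a\<bar> * ennreal \<bar>\<sigma> (A n)\<bar> + ennreal \<bar>b\<bar> * ennreal \<bar>\<tau> (A n)\<bar>)"
      by (intro suminf_le) auto
    also have "\<dots> = ennreal \<bar>a\<bar> * (\<Sum>n. ennreal \<bar>\<sigma> (A n)\<bar>) + ennreal \<bar>b\<bar> * (\<Sum>n. ennreal \<bar>\<tau> (A n)\<bar>)"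
      by (subst suminf_add[symmetric]) auto
    also have "\<dots> \<le> ennreal \<bar>a\<bar> * variation S \<sigma> S + ennreal \<bar>b\<bar> * variation S \<tau> S"
      by (intro add_mono mult_left_mono variation_upper A) auto
    finally show "(\<Sum>n. ennreal \<bar>a * \<sigma> (A n) + b * \<tau> (A n)\<bar>) \<le>
        ennreal \<bar>a\<bar> * variation S \<sigma> S + ennreal \<bar>b\<bar> * variation S \<tau> S" .
  qed
  moreover have "ennreal \<bar>a\<bar> * variation S \<sigma> S + ennreal \<bar>b\<bar> * variation S \<tau> S < \<infinity>"
    using st by (simp add: ennreal_mult_less_top)
  ultimately show ?thesis
    unfolding finite_signed_measure_def by (blast intro: le_less_trans)
qed

text \<open>Jordan parts are not additive, so the parts of the combination cannot be compared with
  those of \<open>\<sigma>\<close> and \<open>\<tau>\<close> one by one. The identity holds only for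
  the signed sum of all six measures.\<close>

lemma signed_integral_lincomb:
  fixes S :: "'a::topological_space set"
  assumes S: "closed S" and s: "finite_signed_measure S \<sigma>" and t: "finite_signed_measure S \<tau>"
    and f: "f \<in> C0 S"
  shows "signed_integral S (\<lambda>E. a * \<sigma> E + b * \<tau> E) f = a * signed_integral S \<sigma> f + b * signed_integral S \<tau> f"
proof -
  let ?u = "\<lambda>E. a * \<sigma> E + b * \<tau> E"
  note J = Jordan_decomposition[OF finite_signed_measure_lincomb[OF s t, of a b]]
    and Js = Jordan_decomposition[OF s] and Jt = Jordan_decomposition[OF t]
  obtain B where B: "\<And>x. \<bar>f x\<bar> \<le> B" using C0_bounded[OF f] by blast
  let ?ms = "[(1, positive_part S ?u), (-1, positive_part S (\<lambda>E. - ?u E)),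
    (-a, positive_part S \<sigma>), (a, positive_part S (\<lambda>E. - \<sigma> E)),
    (-b, positive_part S \<tau>), (b, positive_part S (\<lambda>E. - \<tau> E))]"
  have "(\<Sum>(c, M)\<leftarrow>?ms. c * integral\<^sup>L M f) = 0"
  proof (rule weighted_integral_list_eq_0[where R="restrict_space borel S" and B=B])
    fix E assume E: "E \<in> borel_sets S"
    have "a * \<sigma> E = a * measure (positive_part S \<sigma>) E - a * measure (positive_part S (\<lambda>E. - \<sigma> E)) E"
      "b * \<tau> E = b * measure (positive_part S \<tau>) E - b * measure (positive_part S (\<lambda>E. - \<tau> E)) E"
      by (simp_all add: Js(7)[OF E] Jt(7)[OF E] right_diff_distrib)
    then show "(\<Sum>(c, M)\<leftarrow>?ms. c * measure M E) = 0"
      using J(7)[OF E] by simp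
  next
    show "f \<in> borel_measurable (restrict_space borel S)"
      by (rule C0_borel_measurable[OF S refl f])
    show "finite_measure M" "sets M = borel_sets S" if "(c, M) \<in> set ?ms" for c M
      using that J(1,3,4,6) Js(1,3,4,6) Jt(1,3,4,6) by auto
  qed (rule B)
  then show ?thesis by (simp add: J(9) Js(9) Jt(9) algebra_simps)
qed

lemma signed_integral_linear:
  fixes S :: "'a::topological_space set"
  assumes S: "closed S" and s: "finite_signed_measure S \<sigma>" and f: "f \<in> C0 S" and g: "g \<in> C0 S"
  shows "signed_integral S \<sigma> (\<lambda>x. a * f x + b * g x) = a * signed_integral S \<sigma> f + b * signed_integral S \<sigma> g"
proof -
  note J = Jordan_decomposition[OF s]
  have int: "integrable (positive_part S \<sigma>) h" "integrable (positive_part S (\<lambda>E. - \<sigma> E)) h" if "h \<in> C0 S" for h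
    using that J by (auto intro: C0_integrable[OF S])
  show ?thesis
    unfolding J(9) using int[OF f] int[OF g] by (simp add: algebra_simps)
qed

text \<open>Estimating the Jordan parts separately gives the constant \<open>tv_norm\<close>,
  because their masses add up to exactly that.\<close>

lemma signed_integral_bound:
  fixes S :: "'a::topological_space set"
  assumes S: "closed S" and s: "finite_signed_measure S \<sigma>" and f: "f \<in> C0 S"
  shows "\<bar>signed_integral S \<sigma> f\<bar> \<le> tv_norm S \<sigma> * sup_norm S f"
proof -
  note J = Jordan_decomposition[OF s]
  have bound: "\<bar>integral\<^sup>L M f\<bar> \<le> measure M S * sup_norm S f"
    if M: "sets M = borel_sets S" "space M = S" "finite_measure M" for M
  proof -
    interpret finite_measure M by (rule M(3))
    have "\<bar>integral\<^sup>L M f\<bar> \<le> integral\<^sup>L M (\<lambda>x. \<bar>f x\<bar>)"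
      by (rule integral_abs_bound)
    also have "\<dots> \<le> integral\<^sup>L M (\<lambda>x. sup_norm S f)"
      using C0_integrable[OF S M(1,3) f] sup_norm_upper[OF f] by (intro integral_mono) auto
    finally show ?thesis by (simp add: M(2))
  qed
  have "\<bar>signed_integral S \<sigma> f\<bar> \<le> \<bar>integral\<^sup>L (positive_part S \<sigma>) f\<bar> + \<bar>integral\<^sup>L (positive_part S (\<lambda>E. - \<sigma> E)) f\<bar>"
    unfolding J(9) by linarith
  also have "\<dots> \<le> measure (positive_part S \<sigma>) S * sup_norm S f + measure (positive_part S (\<lambda>E. - \<sigma> E)) S * sup_norm S f"
    using J by (intro add_mono bound)
  also have "\<dots> = tv_norm S \<sigma> * sup_norm S f"
    by (simp add: J(8)[symmetric] distrib_right)
  finally show ?thesis .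
qed

section \<open>The integral RKBS and its predual\<close>

lemma C0_section_snd:
  fixes \<phi> :: "'a::topological_space \<times> 'b::topological_space \<Rightarrow> real"
  assumes \<phi>: "\<phi> \<in> C0 (X \<times> \<Omega>)" and x: "x \<in> X"
  shows "(\<lambda>w. \<phi> (x, w)) \<in> C0 \<Omega>"
proof -
  have "\<exists>K. compact K \<and> K \<subseteq> \<Omega> \<and> (\<forall>w\<in>\<Omega> - K. \<bar>\<phi> (x, w)\<bar> < e)" if e: "0 < e" for e
  proof -
    obtain K where K: "compact K" "K \<subseteq> X \<times> \<Omega>" "\<And>z. z \<in> X \<times> \<Omega> - K \<Longrightarrow> \<bar>\<phi> z\<bar> < e"
      using C0D(3)[OF \<phi> e] by auto
    \<comment> \<open>The projection of \<open>K\<close> is the required compact set: for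
      \<open>w\<close> outside it, no pair \<open>(x, w)\<close> lies in \<open>K\<close>.\<close>
    have "compact (snd ` K)"
      using K(1) by (intro compact_continuous_image continuous_intros)
    moreover have "\<bar>\<phi> (x, w)\<bar> < e" if "w \<in> \<Omega> - snd ` K" for w
      using that x by (intro K(3)) force
    ultimately show ?thesis using K(2) by (intro exI[of _ "snd ` K"]) auto
  qed
  moreover have "continuous_on \<Omega> (\<lambda>w. \<phi> (x, w))"
    using x by (intro continuous_on_compose2[OF C0D(1)[OF \<phi>]] continuous_intros) auto
  ultimately show ?thesis using C0D(2)[OF \<phi>] by (auto simp: C0_def)
qed

lemma C0_section_fst:
  fixes \<phi> :: "'a::topological_space \<times> 'b::topological_space \<Rightarrow> real"
  assumes \<phi>: "\<phi> \<in> C0 (X \<times> \<Omega>)" and w: "w \<in> \<Omega>"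
  shows "(\<lambda>x. \<phi> (x, w)) \<in> C0 X"
proof -
  have "\<exists>K. compact K \<and> K \<subseteq> X \<and> (\<forall>x\<in>X - K. \<bar>\<phi> (x, w)\<bar> < e)" if e: "0 < e" for e
  proof -
    obtain K where K: "compact K" "K \<subseteq> X \<times> \<Omega>" "\<And>z. z \<in> X \<times> \<Omega> - K \<Longrightarrow> \<bar>\<phi> z\<bar> < e"
      using C0D(3)[OF \<phi> e] by auto
    have "compact (fst ` K)"
      using K(1) by (intro compact_continuous_image continuous_intros)
    moreover have "\<bar>\<phi> (x, w)\<bar> < e" if "x \<in> X - fst ` K" for x
      using that w by (intro K(3)) force
    ultimately show ?thesis using K(2) by (intro exI[of _ "fst ` K"]) auto
  qed
  moreover have "continuous_on X (\<lambda>x. \<phi> (x, w))"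
    using w by (intro continuous_on_compose2[OF C0D(1)[OF \<phi>]] continuous_intros) auto
  ultimately show ?thesis using C0D(2)[OF \<phi>] by (auto simp: C0_def)
qed

text \<open>\<open>\<phi>\<close> is bounded and the product measure is finite, which gives
  integrability. Second countability enters through \<open>borel_prod\<close>: Borel functions on
  the product space are measurable for the product sigma-algebra.\<close>

lemma C0_Fubini:
  fixes \<phi> :: "'a::second_countable_topology \<times> 'b::second_countable_topology \<Rightarrow> real"
  assumes X: "closed X" and \<Omega>: "closed \<Omega>" and \<phi>: "\<phi> \<in> C0 (X \<times> \<Omega>)"
    and M: "sets M = borel_sets X" "finite_measure M" and N: "sets N = borel_sets \<Omega>" "finite_measure N"
  shows "integrable M (\<lambda>x. \<integral>w. \<phi> (x, w) \<partial>N)" "integrable N (\<lambda>w. \<integral>x. \<phi> (x, w) \<partial>M)"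
    "(\<integral>x. (\<integral>w. \<phi> (x, w) \<partial>N) \<partial>M) = (\<integral>w. (\<integral>x. \<phi> (x, w) \<partial>M) \<partial>N)"
proof -
  interpret M: finite_measure M by (rule M(2))
  interpret N: finite_measure N by (rule N(2))
  interpret pair_sigma_finite M N ..
  interpret MN: finite_measure "M \<Otimes>\<^sub>M N"
    by (intro finite_measure_pair_measure M N)
  obtain B where B: "\<And>z. \<bar>\<phi> z\<bar> \<le> B" using C0_bounded[OF \<phi>] by blast
  have [measurable]: "\<phi> \<in> borel_measurable (borel \<Otimes>\<^sub>M borel)"
    using borel_measurable_C0[OF closed_Times[OF X \<Omega>] \<phi>] by (simp add: borel_prod)
  have [measurable]: "(\<lambda>x. x) \<in> measurable M borel" "(\<lambda>x. x) \<in> measurable N borel"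
    using measurable_ident_borel_sets M(1) N(1) by blast+
  have "(\<lambda>z. (fst z, snd z)) \<in> measurable (M \<Otimes>\<^sub>M N) (borel \<Otimes>\<^sub>M borel)"
    by measurable
  then have "\<phi> \<in> borel_measurable (M \<Otimes>\<^sub>M N)"
    using measurable_compose[of "\<lambda>z. z" "M \<Otimes>\<^sub>M N" "borel \<Otimes>\<^sub>M borel" \<phi> borel] by simp
  then have int: "integrable (M \<Otimes>\<^sub>M N) \<phi>"
    using B by (intro MN.integrable_const_bound[of _ B]) auto
  then have int': "integrable (M \<Otimes>\<^sub>M N) (case_prod (\<lambda>x w. \<phi> (x, w)))" by simp
  show "integrable M (\<lambda>x. \<integral>w. \<phi> (x, w) \<partial>N)" using integrable_fst'[OF int] .
  show "integrable N (\<lambda>w. \<integral>x. \<phi> (x, w) \<partial>M)" using integrable_snd[OF int'] by simp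
  show "(\<integral>x. (\<integral>w. \<phi> (x, w) \<partial>N) \<partial>M) = (\<integral>w. (\<integral>x. \<phi> (x, w) \<partial>M) \<partial>N)"
    using Fubini_integral[OF int'] by simp
qed

text \<open>Expanding both sides into Jordan parts leaves four pairs of finite positive measures,
  and \<open>C0_Fubini\<close> exchanges each pair.\<close>

lemma signed_Fubini:
  fixes \<phi> :: "'a::second_countable_topology \<times> 'b::second_countable_topology \<Rightarrow> real"
  assumes X: "closed X" and \<Omega>: "closed \<Omega>" and \<phi>: "\<phi> \<in> C0 (X \<times> \<Omega>)"
    and \<rho>: "finite_signed_measure X \<rho>" and \<sigma>: "finite_signed_measure \<Omega> \<sigma>"
  shows "signed_integral \<Omega> \<sigma> (A_adj \<phi> X \<Omega> \<rho>) = signed_integral X \<rho> (A_op \<phi> X \<Omega> \<sigma>)"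
proof -
  note J\<rho> = Jordan_decomposition[OF \<rho>] and J\<sigma> = Jordan_decomposition[OF \<sigma>]
  define P N P' N' where "P = positive_part X \<rho>" "N = positive_part X (\<lambda>E. - \<rho> E)"
    "P' = positive_part \<Omega> \<sigma>" "N' = positive_part \<Omega> (\<lambda>E. - \<sigma> E)"
  note PN = J\<rho>(1-6)[folded P_N_P'_N'_def] J\<sigma>(1-6)[folded P_N_P'_N'_def]
  note int\<rho> = J\<rho>(9)[folded P_N_P'_N'_def] and int\<sigma> = J\<sigma>(9)[folded P_N_P'_N'_def]
  note F = C0_Fubini[OF X \<Omega> \<phi>]
  have adj: "integral\<^sup>L M (A_adj \<phi> X \<Omega> \<rho>) = (\<integral>w. (\<integral>x. \<phi> (x, w) \<partial>P) \<partial>M) - (\<integral>w. (\<integral>x. \<phi> (x, w) \<partial>N) \<partial>M)"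
    if M: "sets M = borel_sets \<Omega>" "space M = \<Omega>" "finite_measure M" for M
  proof -
    have "integral\<^sup>L M (A_adj \<phi> X \<Omega> \<rho>) = (\<integral>w. (\<integral>x. \<phi> (x, w) \<partial>P) - (\<integral>x. \<phi> (x, w) \<partial>N) \<partial>M)"
      by (intro Bochner_Integration.integral_cong) (auto simp: A_adj_def int\<rho> M(2))
    also have "\<dots> = (\<integral>w. (\<integral>x. \<phi> (x, w) \<partial>P) \<partial>M) - (\<integral>w. (\<integral>x. \<phi> (x, w) \<partial>N) \<partial>M)"
      using PN M by (intro Bochner_Integration.integral_diff F(2))
    finally show ?thesis .
  qed
  have op: "integral\<^sup>L M (A_op \<phi> X \<Omega> \<sigma>) = (\<integral>x. (\<integral>w. \<phi> (x, w) \<partial>P') \<partial>M) - (\<integral>x. (\<integral>w. \<phi> (x, w) \<partial>N') \<partial>M)"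
    if M: "sets M = borel_sets X" "space M = X" "finite_measure M" for M
  proof -
    have "integral\<^sup>L M (A_op \<phi> X \<Omega> \<sigma>) = (\<integral>x. (\<integral>w. \<phi> (x, w) \<partial>P') - (\<integral>w. \<phi> (x, w) \<partial>N') \<partial>M)"
      by (intro Bochner_Integration.integral_cong) (auto simp: A_op_def int\<sigma> M(2))
    also have "\<dots> = (\<integral>x. (\<integral>w. \<phi> (x, w) \<partial>P') \<partial>M) - (\<integral>x. (\<integral>w. \<phi> (x, w) \<partial>N') \<partial>M)"
      using PN M by (intro Bochner_Integration.integral_diff F(1))
    finally show ?thesis .
  qed
  have "signed_integral \<Omega> \<sigma> (A_adj \<phi> X \<Omega> \<rho>) =
      (\<integral>w. (\<integral>x. \<phi> (x, w) \<partial>P) \<partial>P') - (\<integral>w. (\<integral>x. \<phi> (x, w) \<partial>N) \<partial>P') -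
      ((\<integral>w. (\<integral>x. \<phi> (x, w) \<partial>P) \<partial>N') - (\<integral>w. (\<integral>x. \<phi> (x, w) \<partial>N) \<partial>N'))"
    using PN by (simp only: int\<sigma> adj)
  also have "\<dots> = (\<integral>x. (\<integral>w. \<phi> (x, w) \<partial>P') \<partial>P) - (\<integral>x. (\<integral>w. \<phi> (x, w) \<partial>P') \<partial>N) -
      ((\<integral>x. (\<integral>w. \<phi> (x, w) \<partial>N') \<partial>P) - (\<integral>x. (\<integral>w. \<phi> (x, w) \<partial>N') \<partial>N))"
    using PN by (simp only: F(3))
  also have "\<dots> = signed_integral X \<rho> (A_op \<phi> X \<Omega> \<sigma>)"
    using PN by (simp add: int\<rho> op)
  finally show ?thesis .
qed


section \<open>Point masses, dual norms and the space \<open>G_space\<close>\<close>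

lemma Dirac_measure:
  fixes X :: "'a::topological_space set"
  assumes X: "closed X" and x: "x \<in> X"
  obtains \<delta> where "finite_signed_measure X \<delta>" "\<And>f. f \<in> C0 X \<Longrightarrow> signed_integral X \<delta> f = f x"
proof -
  let ?R = "restrict_space borel X"
  define M where "M = distr (count_space {()}) ?R (\<lambda>_. x)"
  \<comment> \<open>The point mass is written as \<open>M\<close> minus the zero measure to fit
    \<open>signed_integral_diff\<close>.\<close>
  define N where "N = (null_measure ?R)"
  define \<delta> where "\<delta> E = (if E \<in> borel_sets X then measure M E - measure N E else 0)" for E
  have x': "(\<lambda>_. x) \<in> measurable (count_space {()}) ?R" using x by simp
  have M: "sets M = borel_sets X" "finite_measure M"
    using x by (auto simp: M_def intro!: finite_measure.finite_measure_distr finite_measure_count_space)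
  have N: "sets N = borel_sets X" "finite_measure N"
    by (auto simp: N_def intro!: finite_measureI)
  show thesis
  proof
    show "finite_signed_measure X \<delta>"
      by (rule finite_signed_measureI_diff(1)[OF M N]) (auto simp: \<delta>_def)
    fix f assume f: "f \<in> C0 X"
    have fm: "f \<in> borel_measurable ?R" by (rule C0_borel_measurable[OF X refl f])
    have "signed_integral X \<delta> f = integral\<^sup>L M f - integral\<^sup>L N f"
      by (rule signed_integral_diff[OF X M N _ _ f]) (auto simp: \<delta>_def)
    also have "integral\<^sup>L M f = f x"
      unfolding M_def by (subst integral_distr[OF x' fm]) (simp add: lebesgue_integral_count_space_finite)
    also have "integral\<^sup>L N f = 0"
      using fm unfolding N_def by (intro has_bochner_integral_integral_eq) auto
    finally show "signed_integral X \<delta> f = f x" by simp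
  qed
qed

text \<open>\<open>dual_norm\<close> is a supremum of reals, so the bound \<open>C\<close> from
  membership in the dual must first show that it is a genuine upper bound;
  \<open>\<bar>C\<bar>\<close> appears because \<open>C\<close> may be negative. Rescaling to norm 1
  then gives the estimate for all of \<open>G\<close>.\<close>

lemma dual_norm_bound:
  assumes G: "function_space G" "G \<subseteq> C0 S" and L: "L \<in> dual_space G (sup_norm S)"
  shows "0 \<le> dual_norm G (sup_norm S) L"
    and "g \<in> G \<Longrightarrow> \<bar>L g\<bar> \<le> dual_norm G (sup_norm S) L * sup_norm S g"
proof -
  note G' = function_spaceD[OF G(1)]
  obtain C where C: "\<And>g. g \<in> G \<Longrightarrow> \<bar>L g\<bar> \<le> C * sup_norm S g"
    using L by (auto simp: dual_space_def)
  have L_mult: "L (\<lambda>i. c * g i) = c * L g" if "g \<in> G" for c g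
    using L that by (auto simp: dual_space_def linear_on_space_def)
  have L0: "L (\<lambda>i. 0) = 0" using L_mult[OF G'(1), of 0] by simp
  have norm0: "sup_norm S (\<lambda>i. 0) \<le> 0" by (intro sup_norm_least) auto
  have bdd: "bdd_above ((\<lambda>f. \<bar>L f\<bar>) ` {f \<in> G. sup_norm S f \<le> 1})"
  proof (rule bdd_aboveI2)
    fix g assume g: "g \<in> {f \<in> G. sup_norm S f \<le> 1}"
    then have "\<bar>L g\<bar> \<le> C * sup_norm S g" using C by auto
    also have "\<dots> \<le> \<bar>C\<bar> * 1"
      using g sup_norm_upper(2)[of g S] G(2) by (intro mult_mono) auto
    finally show "\<bar>L g\<bar> \<le> \<bar>C\<bar>" by simp
  qed
  have upper: "\<bar>L g\<bar> \<le> dual_norm G (sup_norm S) L" if "g \<in> G" "sup_norm S g \<le> 1" for g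
    unfolding dual_norm_def using that by (intro cSUP_upper[OF _ bdd]) auto
  show "0 \<le> dual_norm G (sup_norm S) L"
    using upper[OF G'(1)] norm0 L0 by simp
  show "\<bar>L g\<bar> \<le> dual_norm G (sup_norm S) L * sup_norm S g" if g: "g \<in> G"
  proof (cases "sup_norm S g = 0")
    \<comment> \<open>A function of norm 0 cannot be rescaled, but the bound with \<open>C\<close>
      already gives \<open>L g = 0\<close>.\<close>
    case True
    then show ?thesis using C[OF g] by simp
  next
    case False
    define n where "n = sup_norm S g"
    have gn: "\<bar>g x\<bar> \<le> n" for x unfolding n_def using sup_norm_upper(1) g G(2) by blast
    have n: "0 < n" unfolding n_def using False sup_norm_upper(2)[of g S] g G(2) by force
    have "sup_norm S (\<lambda>i. (1 / n) * g i) \<le> 1"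
      using gn n by (intro sup_norm_least) (auto simp: field_simps abs_mult)
    then have "\<bar>L (\<lambda>i. (1 / n) * g i)\<bar> \<le> dual_norm G (sup_norm S) L"
      by (intro upper G' g)
    moreover have "L (\<lambda>i. (1 / n) * g i) = L g / n" using L_mult[OF g, of "1 / n"] by simp
    ultimately have "\<bar>L g\<bar> / n \<le> dual_norm G (sup_norm S) L" using n by simp
    then show ?thesis using n by (simp add: n_def[symmetric] field_simps)
  qed
qed

lemma dual_norm_least:
  assumes G: "function_space G" and "0 \<le> c" "\<And>g. g \<in> G \<Longrightarrow> \<bar>L g\<bar> \<le> c * sup_norm S g"
  shows "dual_norm G (sup_norm S) L \<le> c"
  unfolding dual_norm_def
proof (rule cSUP_least)
  have "sup_norm S (\<lambda>i. 0) \<le> 1" by (intro sup_norm_least) auto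
  then show "{f \<in> G. sup_norm S f \<le> 1} \<noteq> {}" using function_spaceD(1)[OF G] by auto
  show "\<bar>L g\<bar> \<le> c" if "g \<in> {f \<in> G. sup_norm S f \<le> 1}" for g
    using assms(3)[of g] mult_left_mono[of "sup_norm S g" 1 c] assms(2) that by auto
qed

lemma function_space_G_space:
  fixes \<phi> :: "'a::{second_countable_topology, complete_space} \<times> 'b::topological_space \<Rightarrow> real"
  assumes X: "closed X" and \<phi>: "\<phi> \<in> C0 (X \<times> \<Omega>)"
  shows "function_space (G_space \<phi> X \<Omega>)"
proof -
  have adj: "A_adj \<phi> X \<Omega> (\<lambda>E. a * \<rho> E + b * \<tau> E) = (\<lambda>w. a * A_adj \<phi> X \<Omega> \<rho> w + b * A_adj \<phi> X \<Omega> \<tau> w)"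
    if "finite_signed_measure X \<rho>" "finite_signed_measure X \<tau>" for a b \<rho> \<tau>
    using signed_integral_lincomb[OF X that C0_section_fst[OF \<phi>]] by (auto simp: A_adj_def)
  have lin: "(\<lambda>w. a * f w + b * g w) \<in> G_space \<phi> X \<Omega>"
    if fg: "f \<in> G_space \<phi> X \<Omega>" "g \<in> G_space \<phi> X \<Omega>" for a b f g
  proof -
    obtain \<rho> \<tau> where rt: "finite_signed_measure X \<rho>" "finite_signed_measure X \<tau>"
        "f = A_adj \<phi> X \<Omega> \<rho>" "g = A_adj \<phi> X \<Omega> \<tau>"
      using fg by (auto simp: G_space_def radon_measures_iff[OF X])
    have "(\<lambda>w. a * f w + b * g w) = A_adj \<phi> X \<Omega> (\<lambda>E. a * \<rho> E + b * \<tau> E)"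
      by (simp add: adj rt)
    moreover have "(\<lambda>w. a * f w + b * g w) \<in> C0 \<Omega>"
      using fg by (intro C0_linear_combination) (auto simp: G_space_def)
    ultimately show ?thesis
      using radon_measures_iff[OF X, THEN iffD2, OF finite_signed_measure_lincomb[OF rt(1,2), of a b]]
      unfolding G_space_def by auto
  qed
  have "finite_signed_measure X (\<lambda>E. 0)"
  proof -
    have "variation X (\<lambda>E. 0) X \<le> 0" by (intro variation_least) simp
    then show ?thesis by (simp add: finite_signed_measure_def signed_measure_def)
  qed
  \<comment> \<open>Linearity with both coefficients 0 evaluates the integral against the zero
    measure.\<close>
  moreover have "A_adj \<phi> X \<Omega> (\<lambda>E. 0) = (\<lambda>w. 0)"
    using adj[OF calculation calculation, of 0 0] by simp
  moreover have "(\<lambda>w. 0) \<in> C0 \<Omega>" by (auto simp: C0_def intro!: exI[of _ "{}"])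
  ultimately have "(\<lambda>w. 0) \<in> G_space \<phi> X \<Omega>"
    using radon_measures_iff[OF X] unfolding G_space_def by blast
  then show ?thesis
    using lin[of _ _ 1 1] lin[of _ _ _ 0] by (auto simp: function_space_def)
qed

lemma section_in_G_space:
  fixes \<phi> :: "'a::{second_countable_topology, complete_space} \<times> 'b::topological_space \<Rightarrow> real"
  assumes X: "closed X" and \<phi>: "\<phi> \<in> C0 (X \<times> \<Omega>)" and x: "x \<in> X"
  shows "(\<lambda>w. \<phi> (x, w)) \<in> G_space \<phi> X \<Omega>"
proof -
  obtain \<delta> where d: "finite_signed_measure X \<delta>" "\<And>f. f \<in> C0 X \<Longrightarrow> signed_integral X \<delta> f = f x"
    using Dirac_measure[OF X x] by blast
  have "A_adj \<phi> X \<Omega> \<delta> = (\<lambda>w. \<phi> (x, w))"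
    using d(2)[OF C0_section_fst[OF \<phi>]] C0D(2)[OF \<phi>] by (auto simp: A_adj_def)
  with d(1) C0_section_snd[OF \<phi> x] show ?thesis
    by (auto simp: G_space_def radon_measures_iff[OF X])
qed

section \<open>Representing measures and the isometry\<close>

lemma Riesz_representation_dual:
  fixes S :: "'a::metric_space set"
  assumes S: "closed S" and G: "function_space G" "G \<subseteq> C0 S" and L: "L \<in> dual_space G (sup_norm S)"
  obtains \<sigma> where "finite_signed_measure S \<sigma>" "tv_norm S \<sigma> \<le> dual_norm G (sup_norm S) L"
    "\<And>g. g \<in> G \<Longrightarrow> L g = signed_integral S \<sigma> g"
proof -
  have lin: "linear_on_space G L" using L by (simp add: dual_space_def)
  have le: "L g \<le> dual_norm G (sup_norm S) L * sup_norm S g" if "g \<in> G" for g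
    using dual_norm_bound(2)[OF G L that] by linarith
  obtain M N where MN: "sets M = borel_sets S" "finite_measure M" "sets N = borel_sets S" "finite_measure N"
      "measure M S + measure N S \<le> dual_norm G (sup_norm S) L"
      "\<And>g. g \<in> G \<Longrightarrow> L g = integral\<^sup>L M g - integral\<^sup>L N g"
    using Riesz_representation_subspace[OF S G lin le dual_norm_bound(1)[OF G L]] by blast
  \<comment> \<open>The value 0 off the Borel sets is the convention in
    \<open>signed_measure\<close>.\<close>
  define \<sigma> where "\<sigma> E = (if E \<in> borel_sets S then measure M E - measure N E else 0)" for E
  have \<sigma>: "E \<in> borel_sets S \<Longrightarrow> \<sigma> E = measure M E - measure N E" "E \<notin> borel_sets S \<Longrightarrow> \<sigma> E = 0" for E
    by (auto simp: \<sigma>_def)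
  show thesis
  proof
    show "finite_signed_measure S \<sigma>"
      by (rule finite_signed_measureI_diff(1)[OF MN(1-4)]) (auto simp: \<sigma>)
    have "tv_norm S \<sigma> \<le> measure M S + measure N S"
      by (rule finite_signed_measureI_diff(2)[OF MN(1-4)]) (auto simp: \<sigma>)
    then show "tv_norm S \<sigma> \<le> dual_norm G (sup_norm S) L" using MN(5) by simp
    show "L g = signed_integral S \<sigma> g" if "g \<in> G" for g
      using signed_integral_diff[OF S MN(1-4), of \<sigma> g] \<sigma> MN(6)[OF that] that G(2) by auto
  qed
qed

theorem theorem15:
  fixes X :: "(real ^ 'd) set"
    and \<Omega> :: "(real ^ 'e) set"
    and \<phi> :: "(real ^ 'd) \<times> (real ^ 'e) \<Rightarrow> real"
  assumes "closed X" and "closed \<Omega>"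
    and "\<phi> \<in> C0 (X \<times> \<Omega>)"
  shows "isometrically_isomorphic
           (dual_space (G_space \<phi> X \<Omega>) (G_norm \<Omega>)) (dual_norm (G_space \<phi> X \<Omega>) (G_norm \<Omega>))
           (F_space \<phi> X \<Omega>) (F_norm \<phi> X \<Omega>)"
proof -
  note X = assms(1) and \<Omega> = assms(2) and \<phi> = assms(3)
  let ?G = "G_space \<phi> X \<Omega>"
  let ?D = "dual_space ?G (G_norm \<Omega>)"
  let ?A = "A_op \<phi> X \<Omega>"
  define T where "T L = (\<lambda>x. if x \<in> X then L (\<lambda>w. \<phi> (x, w)) else 0)" for L :: "(real ^ 'e \<Rightarrow> real) \<Rightarrow> real"
  have G: "function_space ?G" "?G \<subseteq> C0 \<Omega>"
    using function_space_G_space[OF X \<phi>] by (auto simp: G_space_def)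
  have sect: "(\<lambda>w. \<phi> (x, w)) \<in> ?G" if "x \<in> X" for x
    by (rule section_in_G_space[OF X \<phi> that])
  \<comment> \<open>Sections of \<open>\<phi>\<close> lie in \<open>?G\<close>, so a representation
    on \<open>?G\<close> alone determines \<open>T L\<close>. Both sides are 0 outside
    \<open>X\<close>, which makes this an equality of functions.\<close>
  have T_rep: "T L = ?A \<sigma>" if "\<And>g. g \<in> ?G \<Longrightarrow> L g = signed_integral \<Omega> \<sigma> g" for L \<sigma>
    using that sect by (auto simp: T_def A_op_def)
  have integral_eq: "signed_integral \<Omega> \<sigma> g = signed_integral \<Omega> \<tau> g"
    if fs: "finite_signed_measure \<Omega> \<sigma>" "finite_signed_measure \<Omega> \<tau>" "?A \<sigma> = ?A \<tau>" and g: "g \<in> ?G" for \<sigma> \<tau> g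
  proof -
    obtain \<rho> where "finite_signed_measure X \<rho>" "g = A_adj \<phi> X \<Omega> \<rho>"
      using g by (auto simp: G_space_def radon_measures_iff[OF X])
    then show ?thesis
      using signed_Fubini[OF X \<Omega> \<phi>] fs by metis
  qed
  have rep: "\<exists>\<sigma>. finite_signed_measure \<Omega> \<sigma> \<and> tv_norm \<Omega> \<sigma> \<le> dual_norm ?G (G_norm \<Omega>) L \<and>
      (\<forall>g\<in>?G. L g = signed_integral \<Omega> \<sigma> g) \<and> T L = ?A \<sigma>" if "L \<in> ?D" for L
    using Riesz_representation_dual[OF \<Omega> G that] T_rep by metis
  have "inj_on T ?D"
  proof (rule inj_onI)
    fix L K assume L: "L \<in> ?D" and K: "K \<in> ?D" and eq: "T L = T K"
    obtain \<sigma> \<tau> where "finite_signed_measure \<Omega> \<sigma>" "\<forall>g\<in>?G. L g = signed_integral \<Omega> \<sigma> g" "T L = ?A \<sigma>"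
      "finite_signed_measure \<Omega> \<tau>" "\<forall>g\<in>?G. K g = signed_integral \<Omega> \<tau> g" "T K = ?A \<tau>"
      using rep[OF L] rep[OF K] by metis
    then have "L g = K g" if "g \<in> ?G" for g
      using integral_eq[of \<sigma> \<tau> g] eq that by simp
    \<comment> \<open>Functionals in \<open>dual_space\<close> are extended by 0, so agreement on
      \<open>?G\<close> is equality.\<close>
    moreover have "L g = 0" "K g = 0" if "g \<notin> ?G" for g
      using L K that by (auto simp: dual_space_def)
    ultimately show "L = K" by (metis ext)
  qed
  moreover have "T ` ?D = F_space \<phi> X \<Omega>"
  proof
    show "T ` ?D \<subseteq> F_space \<phi> X \<Omega>"
      using rep by (fastforce simp: F_space_def radon_measures_iff[OF \<Omega>])
    show "F_space \<phi> X \<Omega> \<subseteq> T ` ?D"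
    proof
      fix f assume "f \<in> F_space \<phi> X \<Omega>"
      then obtain \<sigma> where \<sigma>: "finite_signed_measure \<Omega> \<sigma>" "f = ?A \<sigma>"
        by (auto simp: F_space_def radon_measures_iff[OF \<Omega>])
      define L where "L g = (if g \<in> ?G then signed_integral \<Omega> \<sigma> g else 0)" for g
      have lin: "signed_integral \<Omega> \<sigma> (\<lambda>w. a * g w + b * h w) =
          a * signed_integral \<Omega> \<sigma> g + b * signed_integral \<Omega> \<sigma> h" if "g \<in> ?G" "h \<in> ?G" for a b g h
        using signed_integral_linear[OF \<Omega> \<sigma>(1)] G(2) that by blast
      have "linear_on_space ?G L"
        unfolding linear_on_space_def
      proof (intro conjI ballI allI)
        show "L (\<lambda>i. g i + h i) = L g + L h" if "g \<in> ?G" "h \<in> ?G" for g h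
          using lin[OF that, of 1 1] function_spaceD(2)[OF G(1) that] that by (simp add: L_def)
        show "L (\<lambda>i. c * g i) = c * L g" if "g \<in> ?G" for c g
          using lin[OF that that, of c 0] function_spaceD(3)[OF G(1) that] that by (simp add: L_def)
      qed
      moreover have "\<forall>g\<in>?G. \<bar>L g\<bar> \<le> tv_norm \<Omega> \<sigma> * G_norm \<Omega> g"
        using signed_integral_bound[OF \<Omega> \<sigma>(1)] G(2) by (auto simp: L_def)
      ultimately have "L \<in> ?D" by (auto simp: dual_space_def L_def)
      moreover have "T L = f" unfolding \<sigma>(2) by (rule T_rep) (simp add: L_def)
      ultimately show "f \<in> T ` ?D" by blast
    qed
  qed
  moreover have "F_norm \<phi> X \<Omega> (T L) = dual_norm ?G (G_norm \<Omega>) L" if L: "L \<in> ?D" for L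
  proof -
    obtain \<sigma> where \<sigma>: "finite_signed_measure \<Omega> \<sigma>" "tv_norm \<Omega> \<sigma> \<le> dual_norm ?G (G_norm \<Omega>) L"
      "\<And>g. g \<in> ?G \<Longrightarrow> L g = signed_integral \<Omega> \<sigma> g" "T L = ?A \<sigma>"
      using rep[OF L] by blast
    let ?M = "{\<mu> \<in> radon_measures \<Omega>. T L = ?A \<mu>}"
    have "\<sigma> \<in> ?M" using \<sigma> by (simp add: radon_measures_iff[OF \<Omega>])
    \<comment> \<open>The infimum is one of reals: this inequality needs the lower bound 0, and the
      reverse one needs \<open>?M\<close> to contain \<open>\<sigma>\<close>.\<close>
    have "F_norm \<phi> X \<Omega> (T L) \<le> tv_norm \<Omega> \<sigma>"
      unfolding F_norm_def using \<open>\<sigma> \<in> ?M\<close>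
      by (intro cINF_lower bdd_belowI2[of _ 0]) (auto simp: tv_norm_def)
    moreover have "dual_norm ?G (G_norm \<Omega>) L \<le> F_norm \<phi> X \<Omega> (T L)"
      unfolding F_norm_def
    proof (rule cINF_greatest)
      fix \<mu> assume "\<mu> \<in> ?M"
      then have \<mu>: "finite_signed_measure \<Omega> \<mu>" "?A \<sigma> = ?A \<mu>"
        using \<sigma>(4) by (auto simp: radon_measures_iff[OF \<Omega>])
      \<comment> \<open>\<open>\<mu>\<close> is an arbitrary competitor in the infimum;
        \<open>integral_eq\<close> makes it represent \<open>L\<close> too, so its norm is an
        admissible constant for \<open>L\<close>.\<close>
      have "\<bar>L g\<bar> \<le> tv_norm \<Omega> \<mu> * G_norm \<Omega> g" if "g \<in> ?G" for g
        using signed_integral_bound[OF \<Omega> \<mu>(1)] G(2) that \<sigma>(3)[OF that] integral_eq[OF \<sigma>(1) \<mu> that] by auto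
      then show "dual_norm ?G (G_norm \<Omega>) L \<le> tv_norm \<Omega> \<mu>"
        by (intro dual_norm_least[OF G(1)]) (simp add: tv_norm_def)
    qed (use \<open>\<sigma> \<in> ?M\<close> in blast)
    ultimately show ?thesis using \<sigma>(2) by simp
  qed
  ultimately show ?thesis
    unfolding isometrically_isomorphic_def bij_betw_def
    by (intro exI[of _ T]) (auto simp: T_def)
qed

end
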